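(* Let $(A_0,A_1)$ be a quasi-Banach couple such that $A_0\cap A_1$ is not closed in $A_0+A_1$, and let $\theta\in(0,1)$. Then the spaces $(A_0,A_1)_{\theta,p}$, $0<p\le\infty$, either collapse (all of them are equal) or they are pairwise distinct (i.e. $(A_0,A_1)_{\theta,p}\neq(A_0,A_1)_{\theta,q}$ whenever $p\neq q$).
   Context: A quasi-Banach couple $(A_0,A_1)$ consists of two quasi-Banach spaces (complete quasi-normed spaces) continuously embedded in a common Hausdorff topological vector space. For $x\in A_0+A_1$ and $t>0$, $K(x,t,A_0,A_1)=\inf\{\|a_0\|_{A_0}+t\|a_1\|_{A_1}: x=a_0+a_1,\ a_j\in A_j,\ j=0,1\}$. The sum carries the quasi-norm $\|x\|_{A_0+A_1}=K(x,1,A_0,A_1)$. For $0<\theta<1$ and $0<p\le\infty$, $(A_0,A_1)_{\theta,p}$ is the space of all $x\in A_0+A_1$ for which $\|x\|_{(A_0,A_1)_{\theta,p}}=\left(\int_0^\infty (t^{-\theta}K(x,t,A_0,A_1))^p\frac{dt}{t}\right)^{1/p}$ (if $p<\infty$) or $\sup_{0<t<\infty}t^{-\theta}K(x,t,A_0,A_1)$ (if $p=\infty$) is finite. Equality of such spaces means equality as sets (the quasi-norms are then automatically equivalent). *)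

theory Defs
  imports "HOL-Analysis.Analysis"
begin

(* Hausdorff topological vector spaces over the reals.  Complex couples are covered by
   restriction of scalars, which changes neither the K-functional nor the spaces below. *)
class hausdorff_real_tvs = real_vector + topological_ab_group_add + t2_space +
  assumes tendsto_scaleR_Pair_tvs:
    "LIM z (nhds c \<times>\<^sub>F nhds x). fst z *\<^sub>R snd z :> nhds (c *\<^sub>R x)"

instance real_normed_vector \<subseteq> hausdorff_real_tvs
proof
  fix c :: real and x :: 'a
  have "filterlim fst (nhds c) (nhds c \<times>\<^sub>F nhds x)" "filterlim snd (nhds x) (nhds c \<times>\<^sub>F nhds x)"
    by (rule filterlim_fst filterlim_snd)+
  then show "LIM z (nhds c \<times>\<^sub>F nhds x). fst z *\<^sub>R snd z :> nhds (c *\<^sub>R x)"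
    by (rule tendsto_scaleR)
qed

(* A quasi-normed space inside an ambient vector space is a subspace A together with a
   function N; the values of N outside A are irrelevant. *)
definition quasi_norm_on :: "'a::real_vector set \<Rightarrow> ('a \<Rightarrow> real) \<Rightarrow> bool" where
  "quasi_norm_on A N \<longleftrightarrow>
     (\<forall>x\<in>A. 0 \<le> N x \<and> (N x = 0 \<longleftrightarrow> x = 0)) \<and>
     (\<forall>c. \<forall>x\<in>A. N (c *\<^sub>R x) = \<bar>c\<bar> * N x) \<and>
     (\<exists>C\<ge>1. \<forall>x\<in>A. \<forall>y\<in>A. N (x + y) \<le> C * (N x + N y))"

definition quasi_complete_on :: "'a::real_vector set \<Rightarrow> ('a \<Rightarrow> real) \<Rightarrow> bool" where
  "quasi_complete_on A N \<longleftrightarrow>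
     (\<forall>u::nat \<Rightarrow> 'a. (\<forall>n. u n \<in> A) \<longrightarrow>
        (\<forall>e>0. \<exists>M. \<forall>m\<ge>M. \<forall>n\<ge>M. N (u m - u n) < e) \<longrightarrow>
        (\<exists>x\<in>A. (\<lambda>n. N (u n - x)) \<longlonglongrightarrow> 0))"

definition quasi_banach :: "'a::real_vector set \<Rightarrow> ('a \<Rightarrow> real) \<Rightarrow> bool" where
  "quasi_banach A N \<longleftrightarrow> subspace A \<and> quasi_norm_on A N \<and> quasi_complete_on A N"

definition quasi_norm_topology :: "'a::real_vector set \<Rightarrow> ('a \<Rightarrow> real) \<Rightarrow> 'a topology" where
  "quasi_norm_topology A N =
     topology (\<lambda>U. U \<subseteq> A \<and> (\<forall>x\<in>U. \<exists>e>0. \<forall>y\<in>A. N (y - x) < e \<longrightarrow> y \<in> U))"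

lemma openin_quasi_norm_topology:
  "openin (quasi_norm_topology A N) U \<longleftrightarrow>
     U \<subseteq> A \<and> (\<forall>x\<in>U. \<exists>e>0. \<forall>y\<in>A. N (y - x) < e \<longrightarrow> y \<in> U)"
proof -
  let ?P = "\<lambda>U. U \<subseteq> A \<and> (\<forall>x\<in>U. \<exists>e>0. \<forall>y\<in>A. N (y - x) < e \<longrightarrow> y \<in> U)"
  have "?P (S \<inter> T)" if S: "?P S" and T: "?P T" for S T
  proof (intro conjI ballI)
    show "S \<inter> T \<subseteq> A" using S by blast
    fix x assume x: "x \<in> S \<inter> T"
    obtain d where d: "d > 0" "\<forall>y\<in>A. N (y - x) < d \<longrightarrow> y \<in> S" using S x by blast
    obtain e where e: "e > 0" "\<forall>y\<in>A. N (y - x) < e \<longrightarrow> y \<in> T" using T x by blast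
    show "\<exists>e>0. \<forall>y\<in>A. N (y - x) < e \<longrightarrow> y \<in> S \<inter> T"
      by (rule exI[of _ "min d e"]) (use d e in auto)
  qed
  moreover have "?P (\<Union>K)" if "\<forall>S\<in>K. ?P S" for K
  proof (intro conjI ballI)
    show "\<Union>K \<subseteq> A" using that by blast
    fix x assume "x \<in> \<Union>K"
    then obtain S where "S \<in> K" "x \<in> S" by blast
    with that obtain e where "e > 0" "\<forall>y\<in>A. N (y - x) < e \<longrightarrow> y \<in> S" by blast
    with \<open>S \<in> K\<close> show "\<exists>e>0. \<forall>y\<in>A. N (y - x) < e \<longrightarrow> y \<in> \<Union>K" by blast
  qed
  ultimately have "istopology ?P" unfolding istopology_def by blast
  then show ?thesis by (simp add: quasi_norm_topology_def topology_inverse')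
qed

lemma topspace_quasi_norm_topology [simp]: "topspace (quasi_norm_topology A N) = A"
proof
  show "topspace (quasi_norm_topology A N) \<subseteq> A"
    using openin_topspace[of "quasi_norm_topology A N"]
    by (simp only: openin_quasi_norm_topology)
  have "openin (quasi_norm_topology A N) A"
    unfolding openin_quasi_norm_topology by (auto intro: exI[of _ 1])
  then show "A \<subseteq> topspace (quasi_norm_topology A N)" by (rule openin_subset)
qed

(* The embeddings into the ambient space are the inclusion maps. *)
definition quasi_banach_couple ::
    "'a::hausdorff_real_tvs set \<Rightarrow> ('a \<Rightarrow> real) \<Rightarrow> 'a set \<Rightarrow> ('a \<Rightarrow> real) \<Rightarrow> bool" where
  "quasi_banach_couple A0 N0 A1 N1 \<longleftrightarrow>
     quasi_banach A0 N0 \<and> quasi_banach A1 N1 \<and>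
     continuous_map (quasi_norm_topology A0 N0) euclidean (\<lambda>x. x) \<and>
     continuous_map (quasi_norm_topology A1 N1) euclidean (\<lambda>x. x)"

definition couple_sum :: "'a::real_vector set \<Rightarrow> 'a set \<Rightarrow> 'a set" where
  "couple_sum A0 A1 = {a0 + a1 | a0 a1. a0 \<in> A0 \<and> a1 \<in> A1}"

(* Only meaningful for x in couple_sum A0 A1; otherwise the infimum is over the empty set. *)
definition K_functional ::
    "'a::real_vector set \<Rightarrow> ('a \<Rightarrow> real) \<Rightarrow> 'a set \<Rightarrow> ('a \<Rightarrow> real) \<Rightarrow> 'a \<Rightarrow> real \<Rightarrow> real" where
  "K_functional A0 N0 A1 N1 x t =
     Inf {N0 a0 + t * N1 a1 | a0 a1. a0 \<in> A0 \<and> a1 \<in> A1 \<and> x = a0 + a1}"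

definition couple_sum_topology ::
    "'a::real_vector set \<Rightarrow> ('a \<Rightarrow> real) \<Rightarrow> 'a set \<Rightarrow> ('a \<Rightarrow> real) \<Rightarrow> 'a topology" where
  "couple_sum_topology A0 N0 A1 N1 =
     quasi_norm_topology (couple_sum A0 A1) (\<lambda>x. K_functional A0 N0 A1 N1 x 1)"

(* The power with exponent 1 / p, for 0 < p, on the extended half-line. *)
definition ennreal_root :: "real \<Rightarrow> ennreal \<Rightarrow> ennreal" where
  "ennreal_root p I = (if I = \<infinity> then \<infinity> else ennreal (enn2real I powr (1 / p)))"

definition interp_norm ::
    "'a::real_vector set \<Rightarrow> ('a \<Rightarrow> real) \<Rightarrow> 'a set \<Rightarrow> ('a \<Rightarrow> real) \<Rightarrow> real \<Rightarrow> ennreal \<Rightarrow> 'a \<Rightarrow> ennreal" where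
  "interp_norm A0 N0 A1 N1 \<theta> p x =
     (if p = \<infinity> then (SUP t\<in>{0<..}. ennreal (t powr (- \<theta>) * K_functional A0 N0 A1 N1 x t))
      else ennreal_root (enn2real p)
        (\<integral>\<^sup>+t\<in>{0<..}. ennreal ((t powr (- \<theta>) * K_functional A0 N0 A1 N1 x t) powr enn2real p / t)
           \<partial>lborel))"

definition interp_space ::
    "'a::real_vector set \<Rightarrow> ('a \<Rightarrow> real) \<Rightarrow> 'a set \<Rightarrow> ('a \<Rightarrow> real) \<Rightarrow> real \<Rightarrow> ennreal \<Rightarrow> 'a set" where
  "interp_space A0 N0 A1 N1 \<theta> p =
     {x \<in> couple_sum A0 A1. interp_norm A0 N0 A1 N1 \<theta> p x < \<infinity>}"

end

theory Submission
  imports Defs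
begin

text \<open>Let \<open>\<Phi>\<^sub>k(x) = a\<^sup>-\<^sup>k\<^sup>\<theta> K(x, a\<^sup>k)\<close> for a large base \<open>a\<close>; then \<open>x\<close> lies in the space with exponent \<open>p\<close> iff
  \<open>\<Phi>(x)\<close> is \<open>p\<close>-summable over the integers. If \<open>v \<in> A\<^sub>0 \<inter> A\<^sub>1\<close>, then \<open>\<Phi>\<^sub>j(v)\<close> is at most
  \<open>a\<^sup>-\<^sup>\<sigma>\<^sup>|\<^sup>j\<^sup>-\<^sup>k\<^sup>|\<close> times the normalised functional \<open>J(v, a\<^sup>k)\<close>, and for large \<open>a\<close> this decay beats the powers of
  the quasi-norm constant that are lost when such estimates are summed.

  Fix a small \<open>\<delta>\<close>. Suppose first that \<open>K(v, a\<^sup>k) \<le> \<delta> J(v, a\<^sup>k)\<close> for all \<open>v \<in> A\<^sub>0 \<inter> A\<^sub>1\<close> and all but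
  finitely many \<open>k\<close>. Decomposing \<open>x\<close> by the fundamental lemma as \<open>\<Sum>\<^sub>k u\<^sub>k\<close> with
  \<open>J(u\<^sub>k, a\<^sup>k) \<lesssim> K(x, a\<^sup>k)\<close> bounds \<open>\<Phi>(x)\<close> by a convolution of \<open>\<Phi>(x)\<close> that is a contraction away
  from a finite window. So a bounded \<open>\<Phi>(x)\<close> decays geometrically, and all spaces are equal. Otherwise
  there are normalised \<open>u\<^sub>n\<close> with \<open>K \<ge> \<delta> J\<close> at arbitrarily sparse positions \<open>k\<^sub>n\<close>, on one side of the
  origin. For \<open>x = \<Sum>\<^sub>n (n+1)\<^sup>-\<^sup>1\<^sup>/\<^sup>p u\<^sub>n\<close> the term \<open>u\<^sub>n\<close> dominates at \<open>k\<^sub>n\<close>, so \<open>\<Phi>(x)\<close> is \<open>q\<close>-summable exactly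
  for \<open>q > p\<close>, and all spaces are distinct.\<close>

section \<open>Quasi-norms and the K-functional\<close>

text \<open>Each addition costs a factor \<open>C\<close>, so the summands need geometric weights.
  After the first one is split off, both it and the rest are at most \<open>B / (2 * C)\<close>, and
  \<open>C\<close> times the sum of two such bounds is \<open>B\<close> again.\<close>

lemma quasi_norm_sum_le:
  fixes v :: "nat \<Rightarrow> 'a::real_vector" and N :: "'a \<Rightarrow> real"
  assumes "subspace A" and C: "1 \<le> C" and "N 0 = 0"
    and add: "\<And>x y. x \<in> A \<Longrightarrow> y \<in> A \<Longrightarrow> N (x + y) \<le> C * (N x + N y)"
    and "\<And>i. v i \<in> A" "0 \<le> B" "\<And>i. i < n \<Longrightarrow> (2 * C) ^ (i + 1) * N (v i) \<le> B"
  shows "N (\<Sum>i<n. v i) \<le> B"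
  using assms(5-)
proof (induction n arbitrary: v B)
  case 0
  then show ?case by (simp add: assms)
next
  case (Suc n)
  have D: "0 < 2 * C" using C by simp
  have "N (\<Sum>i<n. v (Suc i)) \<le> B / (2 * C)"
  proof (rule Suc.IH)
    show "(2 * C) ^ (i + 1) * N (v (Suc i)) \<le> B / (2 * C)" if "i < n" for i
    proof -
      have "(2 * C) * ((2 * C) ^ (i + 1) * N (v (Suc i))) \<le> B"
        using Suc.prems(3)[of "Suc i"] that by (simp add: mult.assoc)
      then show ?thesis using D by (simp add: pos_le_divide_eq mult.commute)
    qed
  qed (use Suc.prems D in auto)
  moreover have "N (v 0) \<le> B / (2 * C)"
    using Suc.prems(3)[of 0] D by (simp add: pos_le_divide_eq mult.commute)
  moreover have "N (\<Sum>i<Suc n. v i) \<le> C * (N (v 0) + N (\<Sum>i<n. v (Suc i)))"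
    unfolding sum.lessThan_Suc_shift
    using Suc.prems(1) by (intro add subspace_sum[OF assms(1)]) auto
  ultimately have "N (\<Sum>i<Suc n. v i) \<le> C * (B / (2 * C) + B / (2 * C))"
    using C mult_left_mono[of "N (v 0) + N (\<Sum>i<n. v (Suc i))" "B / (2 * C) + B / (2 * C)" C]
    by linarith
  also have "\<dots> = B" using C by (simp add: field_simps)
  finally show ?case .
qed

text \<open>Decay like \<open>(4 * C) ^ i\<close> more than pays for the weights
  \<open>(2 * C) ^ i\<close> of finite sums, so the tail from \<open>m\<close> on is at most
  \<open>b m\<close> and the partial sums are Cauchy.\<close>

lemma quasi_complete_geometric:
  fixes v :: "nat \<Rightarrow> 'a::real_vector" and N :: "'a \<Rightarrow> real"
  assumes A: "subspace A" and C: "1 \<le> C" and N0: "N 0 = 0"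
    and add: "\<And>x y. x \<in> A \<Longrightarrow> y \<in> A \<Longrightarrow> N (x + y) \<le> C * (N x + N y)"
    and uminus: "\<And>x. x \<in> A \<Longrightarrow> N (- x) = N x"
    and complete: "quasi_complete_on A N"
    and v: "\<And>i. v i \<in> A" and le: "\<And>i. (4 * C) ^ i * N (v i) \<le> 1"
  shows "\<exists>x\<in>A. (\<lambda>n. N (x - (\<Sum>i<n. v i))) \<longlonglongrightarrow> 0"
proof -
  define s where "s n = (\<Sum>i<n. v i)" for n
  have s: "s n \<in> A" for n using v unfolding s_def by (intro subspace_sum[OF A])
  define b where "b m = 2 * C / (4 * C) ^ m" for m
  have diff_le: "N (s n - s m) \<le> b m" if "m \<le> n" for m n
  proof -
    have "s n - s m = (\<Sum>i<n - m. v (m + i))"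
      using that sum.lessThan_Suc_shift sum_diff_nat_ivl[of 0 m n v]
        sum.shift_bounds_nat_ivl[of v 0 m "n - m"]
      by (simp add: s_def lessThan_atLeast0 add.commute)
    also have "N \<dots> \<le> b m"
    proof (rule quasi_norm_sum_le[OF A C N0 add])
      fix i
      have "(2 * C) ^ i * N (v (m + i)) \<le> 1 / (4 * C) ^ m"
      \<comment> \<open>Nonnegativity of \<open>N\<close> is not among the assumptions, so a
        negative value is treated apart.\<close>
      proof (cases "0 \<le> N (v (m + i))")
        case True
        have "(4 * C) ^ m * ((2 * C) ^ i * N (v (m + i))) \<le> (4 * C) ^ m * ((4 * C) ^ i * N (v (m + i)))"
          using C True by (intro mult_left_mono mult_right_mono power_mono) auto
        also have "\<dots> \<le> 1" using le[of "m + i"] by (simp add: power_add mult.assoc)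
        finally show ?thesis using C by (simp add: field_simps)
      next
        case False
        then have "(2 * C) ^ i * N (v (m + i)) \<le> 0"
          using C by (intro mult_nonneg_nonpos) auto
        also have "0 \<le> 1 / (4 * C) ^ m" using C by simp
        finally show ?thesis .
      qed
      then have "2 * C * ((2 * C) ^ i * N (v (m + i))) \<le> 2 * C * (1 / (4 * C) ^ m)"
        using C by (intro mult_left_mono) auto
      then show "(2 * C) ^ (i + 1) * N (v (m + i)) \<le> b m" by (simp add: b_def mult.assoc)
    qed (use v C in \<open>auto simp: b_def\<close>)
    finally show ?thesis .
  qed
  have "(\<lambda>m. 2 * C * inverse ((4 * C) ^ m)) \<longlonglongrightarrow> 2 * C * 0"
    using C by (intro tendsto_mult tendsto_const LIMSEQ_inverse_realpow_zero) auto
  moreover have "b = (\<lambda>m. 2 * C * inverse ((4 * C) ^ m))"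
    by (simp only: fun_eq_iff b_def divide_inverse) blast
  ultimately have b0: "b \<longlonglongrightarrow> 0" by (simp only: mult_zero_right)
  have "\<exists>M. \<forall>m\<ge>M. \<forall>n\<ge>M. N (s m - s n) < e" if e: "0 < e" for e
  proof -
    obtain M where M: "\<And>m. m \<ge> M \<Longrightarrow> b m < e"
      using order_tendstoD(2)[OF b0 e] unfolding eventually_sequentially by blast
    have "N (s m - s n) < e" if mn: "M \<le> m" "M \<le> n" for m n
    proof (cases "n \<le> m")
      case True
      then show ?thesis using diff_le[of n m] M[OF mn(2)] by linarith
    next
      case False
      have "N (s m - s n) = N (s n - s m)"
        using uminus[OF subspace_diff[OF A s[of n] s[of m]]] by simp
      then show ?thesis using diff_le[of m n] M[OF mn(1)] False by linarith
    qed
    then show ?thesis by blast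
  qed
  then obtain x where x: "x \<in> A" "(\<lambda>n. N (s n - x)) \<longlonglongrightarrow> 0"
    using complete s unfolding quasi_complete_on_def by blast
  have "N (s n - x) = N (x - s n)" for n
    using uminus[OF subspace_diff[OF A x(1) s[of n]]] by simp
  then show ?thesis using x unfolding s_def by auto
qed

text \<open>One constant \<open>C\<close> serves both quasi-norms, so that the K-functional inherits
  the quasi-triangle inequality with the same \<open>C\<close> at every \<open>t\<close>.\<close>

locale quasi_banach_pair =
  fixes A0 A1 :: "'a::real_vector set" and N0 N1 :: "'a \<Rightarrow> real" and C :: real
  assumes sub0: "subspace A0" and sub1: "subspace A1"
    and C_ge_1: "1 \<le> C"
    and N0_nonneg: "x \<in> A0 \<Longrightarrow> 0 \<le> N0 x" and N1_nonneg: "x \<in> A1 \<Longrightarrow> 0 \<le> N1 x"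
    and N0_scale: "x \<in> A0 \<Longrightarrow> N0 (c *\<^sub>R x) = \<bar>c\<bar> * N0 x"
    and N1_scale: "x \<in> A1 \<Longrightarrow> N1 (c *\<^sub>R x) = \<bar>c\<bar> * N1 x"
    and N0_add: "x \<in> A0 \<Longrightarrow> y \<in> A0 \<Longrightarrow> N0 (x + y) \<le> C * (N0 x + N0 y)"
    and N1_add: "x \<in> A1 \<Longrightarrow> y \<in> A1 \<Longrightarrow> N1 (x + y) \<le> C * (N1 x + N1 y)"
    and complete0: "quasi_complete_on A0 N0" and complete1: "quasi_complete_on A1 N1"

lemma quasi_banach_pair_exists:
  assumes "quasi_banach A0 N0" and "quasi_banach A1 N1"
  shows "\<exists>C. quasi_banach_pair A0 A1 N0 N1 C"
proof -
  have n0: "quasi_norm_on A0 N0" and n1: "quasi_norm_on A1 N1"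
    using assms unfolding quasi_banach_def by auto
  obtain C0 where C0: "C0 \<ge> 1" "\<And>x y. x \<in> A0 \<Longrightarrow> y \<in> A0 \<Longrightarrow> N0 (x + y) \<le> C0 * (N0 x + N0 y)"
    using n0[unfolded quasi_norm_on_def, THEN conjunct2, THEN conjunct2] by blast
  obtain C1 where C1: "C1 \<ge> 1" "\<And>x y. x \<in> A1 \<Longrightarrow> y \<in> A1 \<Longrightarrow> N1 (x + y) \<le> C1 * (N1 x + N1 y)"
    using n1[unfolded quasi_norm_on_def, THEN conjunct2, THEN conjunct2] by blast
  have nn0: "\<And>x. x \<in> A0 \<Longrightarrow> 0 \<le> N0 x" and nn1: "\<And>x. x \<in> A1 \<Longrightarrow> 0 \<le> N1 x"
    using n0[unfolded quasi_norm_on_def, THEN conjunct1] n1[unfolded quasi_norm_on_def, THEN conjunct1]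
    by blast+
  have "N0 (x + y) \<le> max C0 C1 * (N0 x + N0 y)" if "x \<in> A0" "y \<in> A0" for x y
    using C0(2)[OF that] mult_right_mono[of C0 "max C0 C1" "N0 x + N0 y"] nn0[OF that(1)] nn0[OF that(2)]
    by linarith
  moreover have "N1 (x + y) \<le> max C0 C1 * (N1 x + N1 y)" if "x \<in> A1" "y \<in> A1" for x y
    using C1(2)[OF that] mult_right_mono[of C1 "max C0 C1" "N1 x + N1 y"] nn1[OF that(1)] nn1[OF that(2)]
    by linarith
  ultimately have "quasi_banach_pair A0 A1 N0 N1 (max C0 C1)"
    using assms n0 n1 C0(1) unfolding quasi_banach_def quasi_norm_on_def
    by unfold_locales auto
  then show ?thesis by blast
qed

section \<open>The sum space with the K- and J-functionals\<close>

context quasi_banach_pair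
begin

abbreviation S where "S \<equiv> couple_sum A0 A1"
abbreviation K where "K \<equiv> K_functional A0 N0 A1 N1"

text \<open>Peetre's J-functional, the counterpart of \<open>K\<close> for elements of
  \<open>A0 \<inter> A1\<close>.\<close>

definition J where "J v t = max (N0 v) (t * N1 v)"

lemma in_S_I: "a0 \<in> A0 \<Longrightarrow> a1 \<in> A1 \<Longrightarrow> a0 + a1 \<in> S"
  unfolding couple_sum_def by blast

lemma A0_S: "x \<in> A0 \<Longrightarrow> x \<in> S"
  using in_S_I[of x 0] subspace_0[OF sub1] by simp

lemma A1_S: "x \<in> A1 \<Longrightarrow> x \<in> S"
  using in_S_I[of 0 x] subspace_0[OF sub0] by simp

lemma subspace_S: "subspace S"
proof (rule subspaceI)
  show "0 \<in> S" using A0_S[OF subspace_0[OF sub0]] .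
  show "x + y \<in> S" if xy: "x \<in> S" "y \<in> S" for x y
  proof -
    obtain a0 a1 b0 b1 where ab: "a0 \<in> A0" "a1 \<in> A1" "b0 \<in> A0" "b1 \<in> A1"
      "x = a0 + a1" "y = b0 + b1"
      using xy unfolding couple_sum_def by blast
    have "(a0 + b0) + (a1 + b1) \<in> S"
      using ab by (intro in_S_I subspace_add[OF sub0] subspace_add[OF sub1])
    moreover have "x + y = (a0 + b0) + (a1 + b1)" using ab by simp
    ultimately show ?thesis by simp
  qed
  show "c *\<^sub>R x \<in> S" if x: "x \<in> S" for c x
  proof -
    obtain a0 a1 where a: "a0 \<in> A0" "a1 \<in> A1" "x = a0 + a1"
      using x unfolding couple_sum_def by blast
    have "c *\<^sub>R a0 + c *\<^sub>R a1 \<in> S"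
      using a by (intro in_S_I subspace_scale[OF sub0] subspace_scale[OF sub1])
    then show ?thesis using a by (simp add: scaleR_add_right)
  qed
qed

lemma N0_minus: "x \<in> A0 \<Longrightarrow> N0 (- x) = N0 x"
  using N0_scale[of x "-1"] by simp

lemma N1_minus: "x \<in> A1 \<Longrightarrow> N1 (- x) = N1 x"
  using N1_scale[of x "-1"] by simp

lemma N0_diff: "x \<in> A0 \<Longrightarrow> y \<in> A0 \<Longrightarrow> N0 (x - y) \<le> C * (N0 x + N0 y)"
  using N0_add[of x "- y"] N0_minus[of y] subspace_neg[OF sub0] by simp

lemma N1_diff: "x \<in> A1 \<Longrightarrow> y \<in> A1 \<Longrightarrow> N1 (x - y) \<le> C * (N1 x + N1 y)"
  using N1_add[of x "- y"] N1_minus[of y] subspace_neg[OF sub1] by simp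

lemma K_le:
  assumes "a0 \<in> A0" "a1 \<in> A1" "0 < t"
  shows "K (a0 + a1) t \<le> N0 a0 + t * N1 a1"
  unfolding K_functional_def
proof (rule cInf_lower)
  show "bdd_below {N0 b0 + t * N1 b1 |b0 b1. b0 \<in> A0 \<and> b1 \<in> A1 \<and> a0 + a1 = b0 + b1}"
    by (rule bdd_belowI[of _ 0]) (use N0_nonneg N1_nonneg assms in auto)
qed (use assms in blast)

lemma K_greatest:
  assumes "x \<in> S"
    and "\<And>a0 a1. a0 \<in> A0 \<Longrightarrow> a1 \<in> A1 \<Longrightarrow> x = a0 + a1 \<Longrightarrow> B \<le> N0 a0 + t * N1 a1"
  shows "B \<le> K x t"
  unfolding K_functional_def
  by (rule cInf_greatest) (use assms in \<open>auto simp: couple_sum_def\<close>)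

lemma K_nonneg: "x \<in> S \<Longrightarrow> 0 < t \<Longrightarrow> 0 \<le> K x t"
  by (rule K_greatest) (use N0_nonneg N1_nonneg in auto)

lemma K_approx:
  assumes "x \<in> S" "K x t < e"
  obtains a0 a1 where "a0 \<in> A0" "a1 \<in> A1" "x = a0 + a1" "N0 a0 + t * N1 a1 < e"
  using K_greatest[OF assms(1), of e t] assms(2) that by (meson not_le)

lemma K_le_N0: "x \<in> A0 \<Longrightarrow> 0 < t \<Longrightarrow> K x t \<le> N0 x"
  using K_le[of x 0 t] subspace_0[OF sub1] N1_scale[of 0 0] by simp

lemma K_le_N1: "x \<in> A1 \<Longrightarrow> 0 < t \<Longrightarrow> K x t \<le> t * N1 x"
  using K_le[of 0 x t] subspace_0[OF sub0] N0_scale[of 0 0] by simp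

lemma K_zero: "0 < t \<Longrightarrow> K 0 t = 0"
  using K_le_N0[of 0 t] K_nonneg[of 0 t] subspace_0[OF sub0] subspace_0[OF subspace_S]
    N0_scale[of 0 0] by simp

lemma K_mono:
  assumes "x \<in> S" "0 < t" "t \<le> s"
  shows "K x t \<le> K x s"
proof (rule K_greatest[OF assms(1)])
  fix a0 a1 assume a: "a0 \<in> A0" "a1 \<in> A1" "x = a0 + a1"
  have "t * N1 a1 \<le> s * N1 a1" using assms(3) N1_nonneg[OF a(2)] by (rule mult_right_mono)
  then show "K x t \<le> N0 a0 + s * N1 a1" using K_le[OF a(1,2) assms(2)] a(3) by simp
qed

text \<open>Multiplying the cost \<open>N0 a0 + s * N1 a1\<close> by \<open>t / s\<close> turns its
  second term into the one at \<open>t\<close> and only shrinks the first. In other words,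
  \<open>K x t / t\<close> is nonincreasing in \<open>t\<close>.\<close>

lemma K_antimono:
  assumes "x \<in> S" "0 < t" "t \<le> s"
  shows "K x s \<le> s / t * K x t"
proof -
  have "t / s * K x s \<le> K x t"
  proof (rule K_greatest[OF assms(1)])
    fix a0 a1 assume a: "a0 \<in> A0" "a1 \<in> A1" "x = a0 + a1"
    have "t / s * K x s \<le> t / s * (N0 a0 + s * N1 a1)"
      using K_le[OF a(1,2), of s] assms a(3) by (intro mult_left_mono) auto
    also have "\<dots> = t / s * N0 a0 + t * N1 a1" using assms by (simp add: field_simps)
    also have "\<dots> \<le> N0 a0 + t * N1 a1"
      using assms N0_nonneg[OF a(1)] mult_right_mono[of "t / s" 1 "N0 a0"] by (simp add: field_simps)
    finally show "t / s * K x s \<le> N0 a0 + t * N1 a1" .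
  qed
  then show ?thesis using assms by (simp add: field_simps)
qed

lemma K_scale:
  assumes "x \<in> S" "0 < t"
  shows "K (c *\<^sub>R x) t = \<bar>c\<bar> * K x t"
proof -
  have le: "K (c *\<^sub>R x) t \<le> \<bar>c\<bar> * K x t" if x: "x \<in> S" for c x
  proof (cases "c = 0")
    case False
    have "K (c *\<^sub>R x) t / \<bar>c\<bar> \<le> K x t"
    proof (rule K_greatest[OF x])
      fix a0 a1 assume a: "a0 \<in> A0" "a1 \<in> A1" "x = a0 + a1"
      have "K (c *\<^sub>R x) t \<le> N0 (c *\<^sub>R a0) + t * N1 (c *\<^sub>R a1)"
        using K_le[of "c *\<^sub>R a0" "c *\<^sub>R a1" t] a assms(2) subspace_scale[OF sub0] subspace_scale[OF sub1]
        by (simp add: scaleR_add_right)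
      then show "K (c *\<^sub>R x) t / \<bar>c\<bar> \<le> N0 a0 + t * N1 a1"
        using False a by (simp add: N0_scale N1_scale field_simps)
    qed
    then show ?thesis using False by (simp add: field_simps)
  qed (simp add: K_zero assms)
  show ?thesis
  proof (cases "c = 0")
    case False
    have "K x t \<le> \<bar>1 / c\<bar> * K (c *\<^sub>R x) t"
      using le[of "c *\<^sub>R x" "1 / c"] False assms subspace_scale[OF subspace_S] by simp
    then have "\<bar>c\<bar> * K x t \<le> K (c *\<^sub>R x) t" using False by (simp add: field_simps)
    then show ?thesis using le[OF assms(1), of c] by simp
  qed (simp add: K_zero assms)
qed

text \<open>The componentwise sum of decompositions of \<open>x\<close> and \<open>y\<close>
  decomposes \<open>x + y\<close>; the two infima are then taken one after the other.\<close>

lemma K_add: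
  assumes "x \<in> S" "y \<in> S" "0 < t"
  shows "K (x + y) t \<le> C * (K x t + K y t)"
proof -
  have "K (x + y) t / C - K y t \<le> K x t"
  proof (rule K_greatest[OF assms(1)])
    fix a0 a1 assume a: "a0 \<in> A0" "a1 \<in> A1" "x = a0 + a1"
    have "K (x + y) t / C - (N0 a0 + t * N1 a1) \<le> K y t"
    proof (rule K_greatest[OF assms(2)])
      fix b0 b1 assume b: "b0 \<in> A0" "b1 \<in> A1" "y = b0 + b1"
      have "K (x + y) t \<le> N0 (a0 + b0) + t * N1 (a1 + b1)"
        using K_le[of "a0 + b0" "a1 + b1" t] a b assms(3) subspace_add[OF sub0] subspace_add[OF sub1]
        by (simp add: algebra_simps)
      also have "\<dots> \<le> C * (N0 a0 + N0 b0) + t * (C * (N1 a1 + N1 b1))"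
        using N0_add[OF a(1) b(1)] N1_add[OF a(2) b(2)] assms(3) by (intro add_mono mult_left_mono) auto
      finally have "K (x + y) t \<le> C * ((N0 a0 + t * N1 a1) + (N0 b0 + t * N1 b1))"
        by (simp add: algebra_simps)
      then show "K (x + y) t / C - (N0 a0 + t * N1 a1) \<le> N0 b0 + t * N1 b1"
        using C_ge_1 by (simp add: field_simps)
    qed
    then show "K (x + y) t / C - K y t \<le> N0 a0 + t * N1 a1" by simp
  qed
  then show ?thesis using C_ge_1 by (simp add: field_simps)
qed

lemma K_minus: "x \<in> S \<Longrightarrow> 0 < t \<Longrightarrow> K (- x) t = K x t"
  using K_scale[of x t "-1"] by simp

lemma K_le_J:
  assumes "v \<in> A0 \<inter> A1" "0 < t"
  shows "K v t \<le> J v t"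
  using K_le_N0[of v t] assms unfolding J_def by auto

lemma J_nonneg: "v \<in> A0 \<inter> A1 \<Longrightarrow> 0 \<le> J v t"
  using N0_nonneg[of v] unfolding J_def by auto

lemma J_scale:
  assumes "v \<in> A0 \<inter> A1"
  shows "J (c *\<^sub>R v) t = \<bar>c\<bar> * J v t"
proof -
  have "J (c *\<^sub>R v) t = max (\<bar>c\<bar> * N0 v) (\<bar>c\<bar> * (t * N1 v))"
    using assms by (simp add: J_def N0_scale N1_scale mult.left_commute)
  then show ?thesis by (simp add: J_def max_mult_distrib_left)
qed

lemma sum_in_S: "(\<And>i. i \<in> F \<Longrightarrow> v i \<in> S) \<Longrightarrow> sum v F \<in> S"
  using subspace_sum[OF subspace_S] .

lemma K_sum_lessThan:
  fixes v :: "nat \<Rightarrow> 'a"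
  assumes "\<And>i. v i \<in> S" "0 < t" "0 \<le> B" "\<And>i. i < n \<Longrightarrow> (2 * C) ^ (i + 1) * K (v i) t \<le> B"
  shows "K (\<Sum>i<n. v i) t \<le> B"
  by (rule quasi_norm_sum_le[OF subspace_S C_ge_1]) (use assms K_zero K_add in auto)

text \<open>The sum is split at \<open>j\<close> into two half-lines, to each of which the one-sided
  estimate applies; joining the halves costs the factor \<open>2 * C\<close>.\<close>

lemma K_sum_finite_int:
  fixes v :: "int \<Rightarrow> 'a"
  assumes v: "\<And>k. v k \<in> S" and t: "0 < t" and B: "0 \<le> B" and F: "finite F"
    and le: "\<And>k. k \<in> F \<Longrightarrow> (2 * C) ^ (nat \<bar>k - j\<bar> + 1) * K (v k) t \<le> B"
  shows "K (sum v F) t \<le> 2 * C * B"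
proof -
  define w where "w k = (if k \<in> F then v k else 0)" for k
  have wS: "w k \<in> S" for k using v subspace_0[OF subspace_S] by (simp add: w_def)
  have wle: "(2 * C) ^ (nat \<bar>k - j\<bar> + 1) * K (w k) t \<le> B" for k
    using le B t by (simp add: w_def K_zero)
  obtain n where n: "\<And>k. k \<in> F \<Longrightarrow> nat \<bar>k - j\<bar> < n"
    using F finite_nat_set_iff_bounded[of "(\<lambda>k. nat \<bar>k - j\<bar>) ` F"] by auto
  have "sum v F = sum w F" by (simp add: w_def)
  also have "\<dots> = sum w {j - int n..<j + int n}"
  proof (rule sum.mono_neutral_left)
    show "F \<subseteq> {j - int n..<j + int n}" using n by fastforce
  qed (auto simp: w_def)
  also have "{j - int n..<j + int n} = (\<lambda>i. j - 1 - int i) ` {..<n} \<union> (\<lambda>i. j + int i) ` {..<n}"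
  proof (intro equalityI subsetI)
    fix k assume k: "k \<in> {j - int n..<j + int n}"
    show "k \<in> (\<lambda>i. j - 1 - int i) ` {..<n} \<union> (\<lambda>i. j + int i) ` {..<n}"
    proof (cases "k < j")
      case True
      then show ?thesis using k by (intro UnI1 image_eqI[of _ _ "nat (j - 1 - k)"]) auto
    next
      case False
      then show ?thesis using k by (intro UnI2 image_eqI[of _ _ "nat (k - j)"]) auto
    qed
  qed auto
  also have "sum w \<dots> = (\<Sum>i<n. w (j - 1 - int i)) + (\<Sum>i<n. w (j + int i))"
    by (subst sum.union_disjoint) (auto simp: sum.reindex inj_on_def)
  finally have eq: "sum v F = (\<Sum>i<n. w (j - 1 - int i)) + (\<Sum>i<n. w (j + int i))" .
  have "K (\<Sum>i<n. w (j - 1 - int i)) t \<le> B"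
  proof (rule K_sum_lessThan[OF wS t B])
    fix i
    \<comment> \<open>The index \<open>j - 1 - int i\<close> has distance \<open>i + 1\<close> from
      \<open>j\<close>, so its given weight has one power more than the one-sided estimate asks
      for.\<close>
    have "(2 * C) ^ (i + 1) \<le> (2 * C) ^ (nat \<bar>(j - 1 - int i) - j\<bar> + 1)"
      using C_ge_1 by (intro power_increasing) auto
    then have "(2 * C) ^ (i + 1) * K (w (j - 1 - int i)) t
        \<le> (2 * C) ^ (nat \<bar>(j - 1 - int i) - j\<bar> + 1) * K (w (j - 1 - int i)) t"
      using K_nonneg[OF wS t] by (rule mult_right_mono)
    also have "\<dots> \<le> B" by (rule wle)
    finally show "(2 * C) ^ (i + 1) * K (w (j - 1 - int i)) t \<le> B" .
  qed
  moreover have "K (\<Sum>i<n. w (j + int i)) t \<le> B"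
    by (rule K_sum_lessThan[OF wS t B]) (use wle[of "j + int _"] in simp)
  moreover have "K (sum v F) t \<le> C * (K (\<Sum>i<n. w (j - 1 - int i)) t + K (\<Sum>i<n. w (j + int i)) t)"
    unfolding eq using wS t by (intro K_add sum_in_S)
  ultimately have "K (sum v F) t \<le> C * (B + B)"
    using C_ge_1 mult_left_mono[of "K (\<Sum>i<n. w (j - 1 - int i)) t + K (\<Sum>i<n. w (j + int i)) t" "B + B" C]
    by linarith
  then show ?thesis by simp
qed

text \<open>Convergence of a two-sided series in the sum space, asked for at every \<open>t\<close>
  because the estimates are made at every scale. The half-open window makes a series of differences
  telescope to the values at \<open>int n\<close> and \<open>- int n\<close>.\<close>

definition K_sums :: "(int \<Rightarrow> 'a) \<Rightarrow> 'a \<Rightarrow> bool" where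
  "K_sums v x \<longleftrightarrow> (\<forall>k. v k \<in> S) \<and> x \<in> S \<and>
     (\<forall>t>0. (\<lambda>n. K (x - (\<Sum>k\<in>{- int n..<int n}. v k)) t) \<longlonglongrightarrow> 0)"

text \<open>The bound for finite windows passes to the limit at the cost of one more factor
  \<open>C\<close>. The resulting \<open>2 * C * C\<close> is rounded up, so that later constants
  are powers of \<open>2 * C\<close>.\<close>

lemma K_sums_le:
  assumes "K_sums v x" and t: "0 < t" and B: "0 \<le> B"
    and le: "\<And>k. (2 * C) ^ (nat \<bar>k - j\<bar> + 1) * K (v k) t \<le> B"
  shows "K x t \<le> (2 * C)\<^sup>2 * B"
proof -
  have v: "v k \<in> S" and x: "x \<in> S"
    and lim: "(\<lambda>n. K (x - (\<Sum>k\<in>{- int n..<int n}. v k)) t) \<longlonglongrightarrow> 0" for k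
    using assms unfolding K_sums_def by auto
  have bound: "K x t \<le> C * (K (x - (\<Sum>k\<in>{- int n..<int n}. v k)) t + 2 * C * B)" for n
  proof -
    let ?s = "\<Sum>k\<in>{- int n..<int n}. v k"
    have s: "?s \<in> S" using v by (intro sum_in_S)
    have "K x t \<le> C * (K (x - ?s) t + K ?s t)"
      using K_add[OF subspace_diff[OF subspace_S x s] s t] by simp
    also have "\<dots> \<le> C * (K (x - ?s) t + 2 * C * B)"
      using K_sum_finite_int[OF v t B _ le, of "{- int n..<int n}"] C_ge_1
      by (intro mult_left_mono add_mono) auto
    finally show ?thesis .
  qed
  have "(\<lambda>n. C * (K (x - (\<Sum>k\<in>{- int n..<int n}. v k)) t + 2 * C * B)) \<longlonglongrightarrow> C * (0 + 2 * C * B)"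
    by (intro tendsto_intros lim)
  then have "K x t \<le> C * (0 + 2 * C * B)" using bound by (intro LIMSEQ_le_const) auto
  also have "\<dots> \<le> (2 * C)\<^sup>2 * B"
    using B C_ge_1 by (simp add: power2_eq_square mult_right_mono)
  finally show ?thesis .
qed

text \<open>Once the window contains \<open>j\<close>, deleting that term shifts the partial sum and
  the limit by the same \<open>v j\<close>. This isolates one dominant term of a series.\<close>

lemma K_sums_remove:
  assumes "K_sums v x"
  shows "K_sums (v(j := 0)) (x - v j)"
proof -
  have v: "v k \<in> S" and x: "x \<in> S" for k using assms unfolding K_sums_def by auto
  have "(\<lambda>n. K (x - v j - (\<Sum>k\<in>{- int n..<int n}. (v(j := 0)) k)) t) \<longlonglongrightarrow> 0" if t: "0 < t" for t
  proof (rule Lim_transform_eventually)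
    show "(\<lambda>n. K (x - (\<Sum>k\<in>{- int n..<int n}. v k)) t) \<longlonglongrightarrow> 0"
      using assms t unfolding K_sums_def by blast
    have "K (x - (\<Sum>k\<in>{- int n..<int n}. v k)) t
        = K (x - v j - (\<Sum>k\<in>{- int n..<int n}. (v(j := 0)) k)) t" if n: "nat \<bar>j\<bar> < n" for n
    proof -
      have j: "j \<in> {- int n..<int n}" using n by auto
      have "(\<Sum>k\<in>{- int n..<int n}. v k) = v j + (\<Sum>k\<in>{- int n..<int n} - {j}. v k)"
        using j by (simp add: sum.remove)
      also have "(\<Sum>k\<in>{- int n..<int n} - {j}. v k) = (\<Sum>k\<in>{- int n..<int n}. (v(j := 0)) k)"
        using j by (subst (2) sum.remove[of _ j]) auto
      finally show ?thesis by (simp add: algebra_simps)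
    qed
    then show "\<forall>\<^sub>F n in sequentially. K (x - (\<Sum>k\<in>{- int n..<int n}. v k)) t
        = K (x - v j - (\<Sum>k\<in>{- int n..<int n}. (v(j := 0)) k)) t"
      unfolding eventually_sequentially by (meson less_eq_Suc_le)
  qed
  then show ?thesis
    using v x subspace_0[OF subspace_S] subspace_diff[OF subspace_S] unfolding K_sums_def by auto
qed

end

section \<open>The discretised K-functional\<close>

text \<open>The room between \<theta> and the endpoints is halved: one \<sigma> exploits a small
  ratio of \<open>K\<close> to \<open>J\<close>, another gives decay in the index. The base
  \<open>a\<close> makes this decay at least \<open>4 * C\<close> per step, of which
  \<open>2 * C\<close> pays for summation and a factor 2 remains.\<close>

locale graded_pair = quasi_banach_pair +
  fixes \<theta> a \<sigma> :: real
  assumes \<theta>: "0 < \<theta>" "\<theta> < 1"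
    and \<sigma>: "0 < \<sigma>" "2 * \<sigma> \<le> \<theta>" "2 * \<sigma> \<le> 1 - \<theta>"
    and a_gt_1: "1 < a"
    and a_large: "4 * C \<le> a powr \<sigma>"
begin

definition T :: "int \<Rightarrow> real" where "T k = a powr of_int k"

definition \<Phi> :: "'a \<Rightarrow> int \<Rightarrow> real" where
  "\<Phi> x k = T k powr - \<theta> * K x (T k)"

definition J\<theta> :: "'a \<Rightarrow> int \<Rightarrow> real" where
  "J\<theta> v k = T k powr - \<theta> * J v (T k)"

lemma T_pos: "0 < T k"
  using a_gt_1 by (simp add: T_def)

lemma T_divide: "T j / T k = a powr of_int (j - k)"
  by (simp add: T_def powr_diff)

lemma T_Suc: "T (k + 1) = a * T k"
  using a_gt_1 by (simp add: T_def powr_add)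

lemma T_mono: "j \<le> k \<Longrightarrow> T j \<le> T k"
  using a_gt_1 by (simp add: T_def)

lemma \<Phi>_nonneg: "x \<in> S \<Longrightarrow> 0 \<le> \<Phi> x k"
  using K_nonneg T_pos by (simp add: \<Phi>_def)

section \<open>Off-diagonal decay of the K-functional\<close>

lemma min_le_powr:
  fixes y z s :: real
  assumes "0 < y" "0 < z" "0 \<le> s" "s \<le> 1"
  shows "min y z \<le> y powr s * z powr (1 - s)"
proof -
  have "min y z = min y z powr s * min y z powr (1 - s)"
    using assms by (simp flip: powr_add)
  also have "\<dots> \<le> y powr s * z powr (1 - s)"
    using assms by (intro mult_mono powr_mono2) auto
  finally show ?thesis .
qed

text \<open>Two bounds for \<open>K v s\<close> compete: one carries the ratio \<open>g\<close> over
  from \<open>t\<close> by monotonicity, the other uses a single norm of \<open>v\<close>. Their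
  minimum is at most a geometric mean with exponent \<sigma> on the \<open>g\<close> bound, so the
  factor \<open>g powr \<sigma>\<close> persists at every scale, and the reserve in \<sigma> leaves
  at least a power \<sigma> of decay.\<close>

lemma K_kernel:
  assumes v: "v \<in> A0 \<inter> A1" and g: "0 < g" "g \<le> 1" and K: "K v t \<le> g * J v t"
    and s: "0 < s" and t: "0 < t"
  shows "s powr - \<theta> * K v s \<le> g powr \<sigma> * min (s / t) (t / s) powr \<sigma> * (t powr - \<theta> * J v t)"
proof (cases "s \<le> t")
  case True
  define r where "r = s / t"
  have r: "0 < r" "r \<le> 1" and s_eq: "s = r * t" using True s t by (auto simp: r_def)
  have vS: "v \<in> S" using v A0_S by blast
  have J: "0 \<le> J v t" using J_nonneg[OF v] .
  have "K v s \<le> g * J v t" using K_mono[OF vS s True] K by simp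
  moreover have "K v s \<le> r * J v t"
  proof -
    have "K v s \<le> r * (t * N1 v)" using K_le_N1[of v s] v s s_eq by simp
    also have "\<dots> \<le> r * J v t" using r by (intro mult_left_mono) (auto simp: J_def)
    finally show ?thesis .
  qed
  ultimately have "K v s \<le> min g r * J v t" by (simp add: min_def)
  also have "\<dots> \<le> (g powr \<sigma> * r powr (1 - \<sigma>)) * J v t"
    using min_le_powr[of g r \<sigma>] g r \<sigma> \<theta> J by (intro mult_right_mono) auto
  finally have "s powr - \<theta> * K v s \<le> s powr - \<theta> * ((g powr \<sigma> * r powr (1 - \<sigma>)) * J v t)"
    by (intro mult_left_mono) auto
  also have "s powr - \<theta> * ((g powr \<sigma> * r powr (1 - \<sigma>)) * J v t)
      = g powr \<sigma> * r powr (1 - \<sigma> - \<theta>) * (t powr - \<theta> * J v t)"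
    using r t by (simp add: s_eq powr_mult powr_diff powr_minus divide_inverse mult_ac)
  also have "\<dots> \<le> g powr \<sigma> * r powr \<sigma> * (t powr - \<theta> * J v t)"
    using r \<sigma> J by (intro mult_right_mono mult_left_mono powr_mono') auto
  also have "r = min (s / t) (t / s)"
    using True s t order_trans[of "s / t" 1 "t / s"] by (simp add: r_def min_absorb1)
  finally show ?thesis .
next
  case False
  define r where "r = t / s"
  have r: "0 < r" "r \<le> 1" and s_eq: "s = t / r" using False s t by (auto simp: r_def)
  have vS: "v \<in> S" using v A0_S by blast
  have J: "0 \<le> J v t" using J_nonneg[OF v] .
  have "K v s \<le> J v t" using K_le_N0[of v s] v s by (auto simp: J_def)
  moreover have "K v s \<le> g / r * J v t"
  proof -
    have "K v s \<le> s / t * K v t" using K_antimono[OF vS t] False by simp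
    also have "\<dots> \<le> s / t * (g * J v t)" using K s t by (intro mult_left_mono) auto
    finally show ?thesis using s t by (simp add: r_def mult_ac)
  qed
  ultimately have "K v s \<le> min (g / r) 1 * J v t" by (simp add: min_def)
  also have "\<dots> \<le> ((g / r) powr \<sigma> * 1 powr (1 - \<sigma>)) * J v t"
    using min_le_powr[of "g / r" 1 \<sigma>] g r \<sigma> \<theta> J by (intro mult_right_mono) auto
  finally have "s powr - \<theta> * K v s \<le> s powr - \<theta> * ((g / r) powr \<sigma> * J v t)"
    by (intro mult_left_mono) auto
  also have "s powr - \<theta> * ((g / r) powr \<sigma> * J v t)
      = g powr \<sigma> * r powr (\<theta> - \<sigma>) * (t powr - \<theta> * J v t)"
    using g r t by (simp add: s_eq powr_diff powr_divide powr_minus field_simps)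
  also have "\<dots> \<le> g powr \<sigma> * r powr \<sigma> * (t powr - \<theta> * J v t)"
    using r \<sigma> J by (intro mult_right_mono mult_left_mono powr_mono') auto
  also have "r = min (s / t) (t / s)"
    using False s t order_trans[of "t / s" 1 "s / t"] by (simp add: r_def min_absorb2)
  finally show ?thesis .
qed

text \<open>At the scales \<open>T j\<close> and \<open>T k\<close> the minimum in
  \<open>K_kernel\<close> is \<open>a\<close> to the power \<open>- |k - j|\<close>, and
  \<open>a powr \<sigma>\<close> is at least \<open>4 * C\<close>.\<close>

lemma \<Phi>_kernel:
  assumes v: "v \<in> A0 \<inter> A1" and g: "0 < g" "g \<le> 1" and K: "K v (T k) \<le> g * J v (T k)"
  shows "(4 * C) ^ nat \<bar>k - j\<bar> * \<Phi> v j \<le> g powr \<sigma> * J\<theta> v k"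
proof -
  let ?n = "nat \<bar>k - j\<bar>"
  have JT: "0 \<le> J\<theta> v k" using J_nonneg[OF v] by (simp add: J\<theta>_def)
  have "min (T j / T k) (T k / T j) = a powr - real ?n"
    using a_gt_1 by (auto simp: T_divide min_def abs_if powr_le_cancel_iff)
  then have "\<Phi> v j \<le> g powr \<sigma> * (a powr - real ?n) powr \<sigma> * J\<theta> v k"
    using K_kernel[OF v g K T_pos[of j] T_pos] by (simp add: \<Phi>_def J\<theta>_def)
  also have "(a powr - real ?n) powr \<sigma> = (a powr \<sigma>) powr - real ?n"
    by (simp only: powr_powr mult.commute)
  also have "\<dots> = inverse ((a powr \<sigma>) ^ ?n)"
    using a_gt_1 powr_realpow[of "a powr \<sigma>" ?n] by (simp only: powr_minus) simp
  finally have le: "\<Phi> v j \<le> g powr \<sigma> * inverse ((a powr \<sigma>) ^ ?n) * J\<theta> v k" .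
  have pow: "(4 * C) ^ ?n \<le> (a powr \<sigma>) ^ ?n"
    using a_large C_ge_1 by (intro power_mono) auto
  have "(4 * C) ^ ?n * \<Phi> v j \<le> (a powr \<sigma>) ^ ?n * \<Phi> v j"
    using pow \<Phi>_nonneg[of v j] v A0_S by (intro mult_right_mono) auto
  also have "\<dots> \<le> (a powr \<sigma>) ^ ?n * (g powr \<sigma> * inverse ((a powr \<sigma>) ^ ?n) * J\<theta> v k)"
    using le by (intro mult_left_mono) auto
  also have "\<dots> = g powr \<sigma> * J\<theta> v k" using a_gt_1 by simp
  finally show ?thesis .
qed

text \<open>The decay \<open>4 * C\<close> per step factors as \<open>2 * C\<close>, consumed by the
  summation, times 2, which offsets the growth \<open>2 ^ |k - j|\<close> permitted to the terms.
  Two factors \<open>2 * C\<close> come from \<open>K_sums_le\<close>, and a third from the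
  \<open>+ 1\<close> in its weights.\<close>

lemma \<Phi>_sums_le:
  assumes sums: "K_sums v x" and v: "\<And>k. v k \<in> A0 \<inter> A1"
    and g: "\<And>k. 0 < g k" "\<And>k. g k \<le> 1" and K: "\<And>k. K (v k) (T k) \<le> g k * J (v k) (T k)"
    and B: "\<And>k. g k powr \<sigma> * J\<theta> (v k) k \<le> 2 ^ nat \<bar>k - j\<bar> * B"
  shows "\<Phi> x j \<le> (2 * C) ^ 3 * B"
proof -
  have "0 \<le> g j powr \<sigma> * J\<theta> (v j) j" using J_nonneg[OF v] by (simp add: J\<theta>_def)
  then have B0: "0 \<le> B" using B[of j] by simp
  have "K x (T j) \<le> (2 * C)\<^sup>2 * (2 * C * (T j powr \<theta> * B))"
  proof (rule K_sums_le[OF sums T_pos])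
    show "0 \<le> 2 * C * (T j powr \<theta> * B)" using B0 C_ge_1 by simp
    fix k
    let ?n = "nat \<bar>k - j\<bar>"
    have "(4 * C) ^ ?n * \<Phi> (v k) j \<le> 2 ^ ?n * B"
      using \<Phi>_kernel[OF v g(1) g(2) K] B[of k] by (rule order_trans)
    moreover have "(4 * C) ^ ?n = 2 ^ ?n * (2 * C) ^ ?n"
      using power_mult_distrib[of 2 "2 * C" ?n] by simp
    ultimately have "(2 * C) ^ ?n * \<Phi> (v k) j \<le> B" by (simp only: mult.assoc) simp
    then have "(2 * C) ^ ?n * (T j powr \<theta> * \<Phi> (v k) j) \<le> T j powr \<theta> * B"
      using mult_left_mono[of "(2 * C) ^ ?n * \<Phi> (v k) j" B "T j powr \<theta>"] by (simp add: mult_ac)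
    also have "T j powr \<theta> * \<Phi> (v k) j = K (v k) (T j)"
      using T_pos[of j] by (simp add: \<Phi>_def powr_minus)
    finally show "(2 * C) ^ (?n + 1) * K (v k) (T j) \<le> 2 * C * (T j powr \<theta> * B)"
      using C_ge_1 mult_left_mono[of "(2 * C) ^ ?n * K (v k) (T j)" "T j powr \<theta> * B" "2 * C"]
      by (simp add: mult_ac)
  qed
  then have "T j powr - \<theta> * K x (T j) \<le> T j powr - \<theta> * ((2 * C)\<^sup>2 * (2 * C * (T j powr \<theta> * B)))"
    by (intro mult_left_mono) auto
  also have "\<dots> = (2 * C) ^ 3 * B"
    using T_pos[of j] by (simp add: powr_minus power2_eq_square power3_eq_cube)
  finally show ?thesis by (simp add: \<Phi>_def)
qed

section \<open>The fundamental lemma of interpolation\<close>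

lemma tendsto_T_powr_uminus: "0 < e \<Longrightarrow> (\<lambda>n. T (- int n) powr e) \<longlonglongrightarrow> 0"
proof -
  assume e: "0 < e"
  have "T (- int n) powr e = (a powr - e) ^ n" for n
    using a_gt_1 by (simp add: T_def powr_powr mult.commute flip: powr_realpow)
  moreover have "(\<lambda>n. (a powr - e) ^ n) \<longlonglongrightarrow> 0"
    using a_gt_1 e by (intro LIMSEQ_power_zero) (auto intro!: powr_less_one)
  ultimately show ?thesis by simp
qed

text \<open>Subtracting near-optimal decompositions at consecutive scales gives \<open>u k\<close>,
  which lies in \<open>A0\<close> as a difference of values of \<open>b0\<close> and in
  \<open>A1\<close> as one of \<open>b1\<close>. The bound on \<open>\<Phi> x\<close> makes
  \<open>b0\<close> vanish at the lower end and \<open>b1\<close> at the upper end, so the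
  telescoping series sums to \<open>x\<close>.\<close>

lemma fundamental_decomposition:
  assumes x: "x \<in> S" and pos: "\<And>t. 0 < t \<Longrightarrow> 0 < K x t" and M: "\<And>k. \<Phi> x k \<le> M"
  shows "\<exists>u. K_sums u x \<and> (\<forall>k. u k \<in> A0 \<inter> A1 \<and> J (u k) (T k) \<le> 4 * C * a * K x (T k))"
proof -
  \<comment> \<open>Positivity of \<open>K\<close> puts \<open>2 * K x (T k)\<close> strictly above
    the infimum.\<close>
  have "\<exists>b0 b1. b0 \<in> A0 \<and> b1 \<in> A1 \<and> x = b0 + b1 \<and> N0 b0 + T k * N1 b1 < 2 * K x (T k)" for k
    using K_approx[OF x, of "T k" "2 * K x (T k)"] pos[OF T_pos] by force
  then obtain b0 b1 where b: "\<And>k. b0 k \<in> A0" "\<And>k. b1 k \<in> A1" "\<And>k. x = b0 k + b1 k"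
    and lt: "\<And>k. N0 (b0 k) + T k * N1 (b1 k) < 2 * K x (T k)"
    by metis
  have le0: "N0 (b0 k) \<le> 2 * K x (T k)" and le1: "T k * N1 (b1 k) \<le> 2 * K x (T k)" for k
    using lt[of k] N0_nonneg[OF b(1)[of k]] mult_nonneg_nonneg[OF less_imp_le[OF T_pos] N1_nonneg[OF b(2)[of k]], of k]
    by linarith+
  define u where "u k = b0 (k + 1) - b0 k" for k
  have u1: "u k = b1 k - b1 (k + 1)" for k
    using b(3)[of k] b(3)[of "k + 1"] by (simp add: u_def algebra_simps)
  have uA0: "u k \<in> A0" for k using b(1) subspace_diff[OF sub0] by (simp add: u_def)
  have uA1: "u k \<in> A1" for k using b(2) subspace_diff[OF sub1] by (simp add: u1)
  have Ksuc: "K x (T (k + 1)) \<le> a * K x (T k)" for k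
    using K_antimono[OF x T_pos T_mono[of k "k + 1"]] T_pos[of k] by (simp add: T_Suc)
  have Kle: "K x (T k) \<le> a * K x (T k)" for k
    using a_gt_1 K_nonneg[OF x T_pos] mult_right_mono[of 1 a "K x (T k)"] by simp
  \<comment> \<open>Both neighbouring decompositions are within a factor 2 of optimal, and one step
    of the scale costs \<open>a\<close>; together this gives \<open>4 * C * a\<close>.\<close>
  have J_le: "J (u k) (T k) \<le> 4 * C * a * K x (T k)" for k
  proof -
    have "N0 (u k) \<le> C * (N0 (b0 (k + 1)) + N0 (b0 k))" unfolding u_def by (intro N0_diff b)
    also have "\<dots> \<le> C * (4 * (a * K x (T k)))"
      using le0[of k] le0[of "k + 1"] Ksuc[of k] Kle[of k] C_ge_1 by (intro mult_left_mono) auto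
    finally have 0: "N0 (u k) \<le> 4 * C * a * K x (T k)" by simp
    have "T k * N1 (b1 (k + 1)) \<le> T (k + 1) * N1 (b1 (k + 1))"
      using N1_nonneg[OF b(2)] T_mono[of k "k + 1"] by (intro mult_right_mono) auto
    also have "\<dots> \<le> 2 * (a * K x (T k))" using le1[of "k + 1"] Ksuc[of k] by simp
    finally have "T k * N1 (b1 k) + T k * N1 (b1 (k + 1)) \<le> 4 * (a * K x (T k))"
      using le1[of k] Kle[of k] by simp
    then have "C * (T k * N1 (b1 k) + T k * N1 (b1 (k + 1))) \<le> C * (4 * (a * K x (T k)))"
      using C_ge_1 by (intro mult_left_mono) auto
    moreover have "T k * N1 (u k) \<le> T k * (C * (N1 (b1 k) + N1 (b1 (k + 1))))"
      unfolding u1 using T_pos[of k] by (intro mult_left_mono N1_diff b) auto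
    ultimately have "T k * N1 (u k) \<le> 4 * C * a * K x (T k)" by (simp add: algebra_simps)
    with 0 show ?thesis by (simp add: J_def)
  qed
  have tele: "(\<Sum>k\<in>{- int n..<int n}. u k) = b0 (int n) - b0 (- int n)" for n
  proof (induction n)
    case (Suc n)
    have "{- int (Suc n)..<int (Suc n)} = insert (- int n - 1) (insert (int n) {- int n..<int n})"
      by auto
    then show ?case using Suc by (auto simp: u_def algebra_simps intro: arg_cong[of _ _ b0])
  qed simp
  have KT: "K x (T k) \<le> M * T k powr \<theta>" for k
  proof -
    have "K x (T k) = \<Phi> x k * T k powr \<theta>" using T_pos[of k] by (simp add: \<Phi>_def powr_minus)
    also have "\<dots> \<le> M * T k powr \<theta>" using M by (intro mult_right_mono) auto
    finally show ?thesis .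
  qed
  have "(\<lambda>n. K (x - (\<Sum>k\<in>{- int n..<int n}. u k)) t) \<longlonglongrightarrow> 0" if t: "0 < t" for t
  proof (rule tendsto_sandwich)
    let ?B = "\<lambda>n. 2 * (M * T (- int n) powr \<theta>) + t * (2 * (M * T (- int n) powr (1 - \<theta>)))"
    have in_S: "x - (\<Sum>k\<in>{- int n..<int n}. u k) \<in> S" for n
      using x uA0 A0_S by (intro subspace_diff[OF subspace_S] sum_in_S) auto
    have "K (x - (\<Sum>k\<in>{- int n..<int n}. u k)) t \<le> ?B n" for n
    proof -
      \<comment> \<open>The remainder pairs the \<open>A0\<close> part at the bottom of the window
        with the \<open>A1\<close> part at its top; both are controlled by powers of
        \<open>T (- int n)\<close>.\<close>
      have "x - (\<Sum>k\<in>{- int n..<int n}. u k) = b0 (- int n) + b1 (int n)"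
        using b(3)[of "int n"] by (simp add: tele algebra_simps)
      then have "K (x - (\<Sum>k\<in>{- int n..<int n}. u k)) t \<le> N0 (b0 (- int n)) + t * N1 (b1 (int n))"
        using K_le[OF b(1,2) t] by simp
      also have "\<dots> \<le> ?B n"
      proof (intro add_mono mult_left_mono)
        show "N0 (b0 (- int n)) \<le> 2 * (M * T (- int n) powr \<theta>)"
          using le0[of "- int n"] KT[of "- int n"] by simp
        have "T (int n) * N1 (b1 (int n)) \<le> 2 * (M * T (int n) powr \<theta>)"
          using le1[of "int n"] KT[of "int n"] by simp
        then have "N1 (b1 (int n)) \<le> 2 * (M * (T (int n) powr \<theta> / T (int n)))"
          using T_pos[of "int n"] by (simp add: field_simps)
        also have "T (int n) powr \<theta> / T (int n) = T (- int n) powr (1 - \<theta>)"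
          using a_gt_1 by (simp add: T_def powr_powr flip: powr_diff) (simp add: algebra_simps)
        finally show "N1 (b1 (int n)) \<le> 2 * (M * T (- int n) powr (1 - \<theta>))" .
      qed (use t in simp)
      finally show ?thesis .
    qed
    then show "\<forall>\<^sub>F n in sequentially. K (x - (\<Sum>k\<in>{- int n..<int n}. u k)) t \<le> ?B n" by simp
    show "\<forall>\<^sub>F n in sequentially. 0 \<le> K (x - (\<Sum>k\<in>{- int n..<int n}. u k)) t"
      using K_nonneg[OF in_S t] by simp
    have "?B \<longlonglongrightarrow> 2 * (M * 0) + t * (2 * (M * 0))"
      using \<theta> by (intro tendsto_intros tendsto_T_powr_uminus) auto
    then show "?B \<longlonglongrightarrow> 0" by simp
  qed simp
  then have "K_sums u x" using x uA0 A0_S by (simp add: K_sums_def)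
  then show ?thesis using uA0 uA1 J_le by blast
qed

section \<open>Discretising the interpolation quasi-norms\<close>

lemma T_floor:
  assumes "0 < t"
  shows "T \<lfloor>log a t\<rfloor> \<le> t" "t < T (\<lfloor>log a t\<rfloor> + 1)"
proof -
  have "a powr of_int \<lfloor>log a t\<rfloor> \<le> a powr log a t" using a_gt_1 by simp
  then show "T \<lfloor>log a t\<rfloor> \<le> t" using a_gt_1 assms by (simp add: T_def)
  have "a powr log a t < a powr of_int (\<lfloor>log a t\<rfloor> + 1)"
    using a_gt_1 by (intro powr_less_mono) linarith+
  then show "t < T (\<lfloor>log a t\<rfloor> + 1)" using a_gt_1 assms by (simp add: T_def)
qed

lemma T_interval_unique:
  assumes "T k \<le> t" "t < T (k + 1)" "T j \<le> t" "t < T (j + 1)"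
  shows "j = k"
proof -
  have "T j < T (k + 1)" "T k < T (j + 1)" using assms by linarith+
  then show ?thesis using T_mono[of "k + 1" j] T_mono[of "j + 1" k] by force
qed

text \<open>The intervals \<open>{T j..<T (j + 1)}\<close> are disjoint, so only the index
  \<open>k\<close> contributes at \<open>t\<close>. Step functions can then be integrated by
  exchanging the two integrals.\<close>

lemma nn_integral_step:
  assumes "T k \<le> t" "t < T (k + 1)"
  shows "(\<integral>\<^sup>+j. h j * indicator {T j..<T (j + 1)} t \<partial>count_space UNIV) = (h k :: ennreal)"
proof -
  have "t \<in> {T j..<T (j + 1)} \<longleftrightarrow> j \<in> {k}" for j
    using assms T_interval_unique[OF assms, of j] unfolding atLeastLessThan_iff singleton_iff by blast
  then have "(indicator {T j..<T (j + 1)} t :: ennreal) = indicator {k} j" for j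
    by (simp only: indicator_def)
  then have "(\<integral>\<^sup>+j. h j * indicator {T j..<T (j + 1)} t \<partial>count_space UNIV)
      = (\<integral>\<^sup>+j. h j * indicator {k} j \<partial>count_space UNIV)"
    by (simp only:)
  also have "\<dots> = h k" by (subst nn_integral_indicator_singleton) auto
  finally show ?thesis .
qed

lemma nn_integral_swap_step:
  "(\<integral>\<^sup>+t. (\<integral>\<^sup>+j. ennreal (d j) * indicator {T j..<T (j + 1)} t \<partial>count_space UNIV) \<partial>lborel)
    = (\<integral>\<^sup>+j. ennreal (d j) * ennreal (T (j + 1) - T j) \<partial>count_space UNIV)"
proof -
  have "(\<integral>\<^sup>+t. (\<integral>\<^sup>+j. ennreal (d j) * indicator {T j..<T (j + 1)} t \<partial>count_space UNIV) \<partial>lborel)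
    = (\<integral>\<^sup>+j. (\<integral>\<^sup>+t. ennreal (d j) * indicator {T j..<T (j + 1)} t \<partial>lborel) \<partial>count_space UNIV)"
    by (rule nn_integral_count_space_nn_integral) auto
  also have "\<dots> = (\<integral>\<^sup>+j. ennreal (d j) * ennreal (T (j + 1) - T j) \<partial>count_space UNIV)"
    using T_mono by (intro nn_integral_cong) (simp add: nn_integral_cmult_indicator)
  finally show ?thesis .
qed

text \<open>With \<open>1 / t\<close> estimated by its value at the left endpoint, each interval has
  mass at most \<open>a - 1\<close>, whatever its index.\<close>

lemma nn_integral_le_sum:
  assumes c: "\<And>k. 0 \<le> c k" and f: "\<And>k t. T k \<le> t \<Longrightarrow> t < T (k + 1) \<Longrightarrow> f t \<le> c k"
  shows "(\<integral>\<^sup>+t\<in>{0<..}. ennreal (f t / t) \<partial>lborel)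
    \<le> ennreal (a - 1) * (\<integral>\<^sup>+k. ennreal (c k) \<partial>count_space UNIV)"
proof -
  have "(\<integral>\<^sup>+t\<in>{0<..}. ennreal (f t / t) \<partial>lborel)
      \<le> (\<integral>\<^sup>+t. (\<integral>\<^sup>+j. ennreal (c j / T j) * indicator {T j..<T (j + 1)} t \<partial>count_space UNIV) \<partial>lborel)"
  proof (rule nn_integral_mono)
    fix t :: real
    show "ennreal (f t / t) * indicator {0<..} t
        \<le> (\<integral>\<^sup>+j. ennreal (c j / T j) * indicator {T j..<T (j + 1)} t \<partial>count_space UNIV)"
    proof (cases "0 < t")
      case True
      let ?k = "\<lfloor>log a t\<rfloor>"
      have "f t / t \<le> c ?k / t" using f[OF T_floor[OF True]] True by (simp add: divide_right_mono)
      also have "\<dots> \<le> c ?k / T ?k"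
        using T_floor(1)[OF True] c T_pos True by (intro divide_left_mono) auto
      finally show ?thesis
        using True by (simp add: nn_integral_step[OF T_floor[OF True]] ennreal_leI)
    qed simp
  qed
  also have "\<dots> = (\<integral>\<^sup>+j. ennreal (c j / T j) * ennreal (T (j + 1) - T j) \<partial>count_space UNIV)"
    by (rule nn_integral_swap_step)
  also have "\<dots> = (\<integral>\<^sup>+j. ennreal (a - 1) * ennreal (c j) \<partial>count_space UNIV)"
  proof (rule nn_integral_cong)
    fix j :: int
    have "c j / T j * (T (j + 1) - T j) = (a - 1) * c j"
      using T_pos[of j] unfolding T_Suc by (simp add: field_simps)
    then show "ennreal (c j / T j) * ennreal (T (j + 1) - T j) = ennreal (a - 1) * ennreal (c j)"
      using c[of j] T_pos[of j] T_mono[of j "j + 1"] a_gt_1 by (simp flip: ennreal_mult)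
  qed
  also have "\<dots> = ennreal (a - 1) * (\<integral>\<^sup>+k. ennreal (c k) \<partial>count_space UNIV)"
    by (simp add: nn_integral_cmult)
  finally show ?thesis .
qed

text \<open>The right endpoint bounds \<open>1 / t\<close> from below, so each interval has mass at
  least \<open>(a - 1) / a\<close>.\<close>

lemma sum_le_nn_integral:
  assumes c: "\<And>k. 0 \<le> c k" and f: "\<And>k t. T k \<le> t \<Longrightarrow> t < T (k + 1) \<Longrightarrow> c k \<le> f t"
  shows "ennreal ((a - 1) / a) * (\<integral>\<^sup>+k. ennreal (c k) \<partial>count_space UNIV)
    \<le> (\<integral>\<^sup>+t\<in>{0<..}. ennreal (f t / t) \<partial>lborel)"
proof -
  have "ennreal ((a - 1) / a) * (\<integral>\<^sup>+k. ennreal (c k) \<partial>count_space UNIV)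
      = (\<integral>\<^sup>+j. ennreal ((a - 1) / a) * ennreal (c j) \<partial>count_space UNIV)"
    by (simp add: nn_integral_cmult)
  also have "\<dots> = (\<integral>\<^sup>+j. ennreal (c j / T (j + 1)) * ennreal (T (j + 1) - T j) \<partial>count_space UNIV)"
  proof (rule nn_integral_cong)
    fix j :: int
    have "c j / T (j + 1) * (T (j + 1) - T j) = (a - 1) / a * c j"
      using T_pos[of j] a_gt_1 unfolding T_Suc by (simp add: field_simps)
    then show "ennreal ((a - 1) / a) * ennreal (c j)
        = ennreal (c j / T (j + 1)) * ennreal (T (j + 1) - T j)"
      using c[of j] T_pos[of "j + 1"] T_mono[of j "j + 1"] a_gt_1 by (simp flip: ennreal_mult)
  qed
  also have "\<dots> = (\<integral>\<^sup>+t. (\<integral>\<^sup>+j. ennreal (c j / T (j + 1)) * indicator {T j..<T (j + 1)} t \<partial>count_space UNIV) \<partial>lborel)"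
    by (rule nn_integral_swap_step[symmetric])
  also have "\<dots> \<le> (\<integral>\<^sup>+t\<in>{0<..}. ennreal (f t / t) \<partial>lborel)"
  proof (rule nn_integral_mono)
    fix t :: real
    show "(\<integral>\<^sup>+j. ennreal (c j / T (j + 1)) * indicator {T j..<T (j + 1)} t \<partial>count_space UNIV)
        \<le> ennreal (f t / t) * indicator {0<..} t"
    proof (cases "0 < t")
      case True
      let ?k = "\<lfloor>log a t\<rfloor>"
      have "c ?k / T (?k + 1) \<le> c ?k / t"
        using T_floor(2)[OF True] c T_pos True by (intro divide_left_mono) auto
      also have "\<dots> \<le> f t / t" using f[OF T_floor[OF True]] True by (simp add: divide_right_mono)
      finally show ?thesis
        using True by (simp add: nn_integral_step[OF T_floor[OF True]] ennreal_leI)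
    next
      case False
      then have "t \<notin> {T j..<T (j + 1)}" for j using T_pos[of j] by auto
      then show ?thesis by simp
    qed
  qed
  finally show ?thesis .
qed

text \<open>Within one interval \<open>K x\<close> grows by at most the factor \<open>a\<close>,
  while the weight decreases.\<close>

lemma weighted_K_le:
  assumes x: "x \<in> S" and t: "T k \<le> t" "t < T (k + 1)"
  shows "t powr - \<theta> * K x t \<le> a * \<Phi> x k"
proof -
  have t0: "0 < t" using t T_pos[of k] by linarith
  have "K x t \<le> t / T k * K x (T k)" using K_antimono[OF x T_pos t(1)] .
  also have "\<dots> \<le> a * K x (T k)"
    using t(2)[unfolded T_Suc] T_pos[of k] K_nonneg[OF x T_pos]
    by (intro mult_right_mono) (auto simp: pos_divide_le_eq)
  finally have "t powr - \<theta> * K x t \<le> T k powr - \<theta> * (a * K x (T k))"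
    using \<theta> t T_pos[of k] K_nonneg[OF x t0] by (intro mult_mono powr_mono2') auto
  then show ?thesis by (simp add: \<Phi>_def mult_ac)
qed

text \<open>Within one interval \<open>K x\<close> does not decrease, and the weight loses at most
  the factor \<open>a powr - \<theta>\<close>.\<close>

lemma weighted_K_ge:
  assumes x: "x \<in> S" and t: "T k \<le> t" "t < T (k + 1)"
  shows "a powr - \<theta> * \<Phi> x k \<le> t powr - \<theta> * K x t"
proof -
  have t0: "0 < t" using t T_pos[of k] by linarith
  have "a powr - \<theta> * \<Phi> x k = T (k + 1) powr - \<theta> * K x (T k)"
    using a_gt_1 T_pos[of k] by (simp add: T_Suc \<Phi>_def powr_mult)
  also have "\<dots> \<le> t powr - \<theta> * K x t"
    using \<theta> t t0 K_nonneg[OF x T_pos] K_mono[OF x T_pos t(1)] by (intro mult_mono powr_mono2') auto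
  finally show ?thesis .
qed

text \<open>The integral and the sum bound each other up to constants that depend on
  \<open>a\<close>, \<theta> and \<open>p\<close>. Membership asks for finiteness, which the
  \<open>p\<close>-th root preserves in both directions.\<close>

lemma in_interp_space_iff:
  assumes x: "x \<in> S" and p: "0 < p"
  shows "x \<in> interp_space A0 N0 A1 N1 \<theta> (ennreal p)
    \<longleftrightarrow> (\<integral>\<^sup>+k. ennreal (\<Phi> x k powr p) \<partial>count_space UNIV) < \<infinity>"
proof -
  define I where "I = (\<integral>\<^sup>+t\<in>{0<..}. ennreal ((t powr - \<theta> * K x t) powr p / t) \<partial>lborel)"
  let ?s = "\<integral>\<^sup>+k. ennreal (\<Phi> x k powr p) \<partial>count_space UNIV"
  have cmult: "(\<integral>\<^sup>+k. ennreal (b * \<Phi> x k powr p) \<partial>count_space UNIV) = ennreal b * ?s" if "0 \<le> b" for b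
    using that by (simp add: ennreal_mult nn_integral_cmult)
  have "I \<le> ennreal (a - 1) * (\<integral>\<^sup>+k. ennreal (a powr p * \<Phi> x k powr p) \<partial>count_space UNIV)"
    unfolding I_def
  proof (rule nn_integral_le_sum)
    fix k t assume t: "T k \<le> t" "t < T (k + 1)"
    then have "0 < t" using T_pos[of k] by linarith
    then have "(t powr - \<theta> * K x t) powr p \<le> (a * \<Phi> x k) powr p"
      using weighted_K_le[OF x t] p K_nonneg[OF x] by (intro powr_mono2) auto
    also have "\<dots> = a powr p * \<Phi> x k powr p"
      using \<Phi>_nonneg[OF x] a_gt_1 by (simp add: powr_mult)
    finally show "(t powr - \<theta> * K x t) powr p \<le> a powr p * \<Phi> x k powr p" .
  qed simp
  then have 1: "I \<le> ennreal (a - 1) * (ennreal (a powr p) * ?s)" by (simp add: cmult)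
  have "ennreal ((a - 1) / a) * (\<integral>\<^sup>+k. ennreal ((a powr - \<theta>) powr p * \<Phi> x k powr p) \<partial>count_space UNIV) \<le> I"
    unfolding I_def
  proof (rule sum_le_nn_integral)
    fix k t assume t: "T k \<le> t" "t < T (k + 1)"
    have "(a powr - \<theta>) powr p * \<Phi> x k powr p = (a powr - \<theta> * \<Phi> x k) powr p"
      using \<Phi>_nonneg[OF x] by (simp add: powr_mult)
    also have "\<dots> \<le> (t powr - \<theta> * K x t) powr p"
      using weighted_K_ge[OF x t] p \<Phi>_nonneg[OF x] by (intro powr_mono2) auto
    finally show "(a powr - \<theta>) powr p * \<Phi> x k powr p \<le> (t powr - \<theta> * K x t) powr p" .
  qed simp
  then have 2: "ennreal ((a - 1) / a) * (ennreal ((a powr - \<theta>) powr p) * ?s) \<le> I" by (simp add: cmult)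
  have "x \<in> interp_space A0 N0 A1 N1 \<theta> (ennreal p) \<longleftrightarrow> I < \<infinity>"
    using x p by (auto simp: interp_space_def interp_norm_def I_def ennreal_root_def less_top)
  also have "\<dots> \<longleftrightarrow> ?s < \<infinity>"
  proof
    assume "?s < \<infinity>"
    then have "ennreal (a - 1) * (ennreal (a powr p) * ?s) < \<infinity>" by (simp add: ennreal_mult_less_top)
    with 1 show "I < \<infinity>" by (rule le_less_trans)
  next
    assume "I < \<infinity>"
    with 2 have "ennreal ((a - 1) / a) * (ennreal ((a powr - \<theta>) powr p) * ?s) < \<infinity>"
      by (rule le_less_trans)
    then show "?s < \<infinity>" using a_gt_1 by (auto simp: ennreal_mult_less_top ennreal_eq_0_iff divide_le_0_iff)
  qed
  finally show ?thesis .
qed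

lemma in_interp_space_infinity_iff:
  assumes x: "x \<in> S"
  shows "x \<in> interp_space A0 N0 A1 N1 \<theta> \<infinity> \<longleftrightarrow> (\<exists>M. \<forall>k. \<Phi> x k \<le> M)"
proof -
  let ?s = "SUP t\<in>{0<..}. ennreal (t powr - \<theta> * K x t)"
  have "?s < \<infinity> \<longleftrightarrow> (\<exists>M. \<forall>k. \<Phi> x k \<le> M)"
  proof
    assume fin: "?s < \<infinity>"
    have "\<Phi> x k \<le> enn2real ?s" for k
    proof -
      have "ennreal (\<Phi> x k) \<le> ?s"
        unfolding \<Phi>_def using T_pos by (intro SUP_upper) auto
      then have "enn2real (ennreal (\<Phi> x k)) \<le> enn2real ?s" using fin by (intro enn2real_mono) auto
      then show ?thesis using \<Phi>_nonneg[OF x] by simp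
    qed
    then show "\<exists>M. \<forall>k. \<Phi> x k \<le> M" by blast
  next
    assume "\<exists>M. \<forall>k. \<Phi> x k \<le> M"
    then obtain M where M: "\<And>k. \<Phi> x k \<le> M" by blast
    have "?s \<le> ennreal (a * M)"
    proof (rule SUP_least)
      fix t :: real assume "t \<in> {0<..}"
      then have t: "0 < t" by simp
      have "t powr - \<theta> * K x t \<le> a * M"
        using weighted_K_le[OF x T_floor[OF t]] M[of "\<lfloor>log a t\<rfloor>"] a_gt_1
          mult_left_mono[of "\<Phi> x \<lfloor>log a t\<rfloor>" M a] by linarith
      then show "ennreal (t powr - \<theta> * K x t) \<le> ennreal (a * M)" by (rule ennreal_leI)
    qed
    then show "?s < \<infinity>" by (rule le_less_trans) simp
  qed
  then show ?thesis using x by (simp add: interp_space_def interp_norm_def)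
qed

lemma bounded_of_nn_integral_powr:
  fixes f :: "int \<Rightarrow> real"
  assumes "0 < p" and fin: "(\<integral>\<^sup>+k. ennreal (f k powr p) \<partial>count_space UNIV) < \<infinity>" and "\<And>k. 0 \<le> f k"
  shows "\<exists>M. \<forall>k. f k \<le> M"
proof -
  let ?s = "\<integral>\<^sup>+k. ennreal (f k powr p) \<partial>count_space UNIV"
  have "f k \<le> enn2real ?s powr (1 / p)" for k
  proof -
    have "ennreal (f k powr p) = (\<integral>\<^sup>+j. ennreal (f j powr p) * indicator {k} j \<partial>count_space UNIV)"
      by (simp add: nn_integral_indicator_singleton)
    also have "\<dots> \<le> ?s" by (intro nn_integral_mono) (auto simp: indicator_def)
    finally have "enn2real (ennreal (f k powr p)) \<le> enn2real ?s" using fin by (intro enn2real_mono) auto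
    then have "(f k powr p) powr (1 / p) \<le> enn2real ?s powr (1 / p)"
      using assms(1) by (intro powr_mono2) auto
    then show ?thesis using assms(1) assms(3)[of k] by (simp add: powr_powr)
  qed
  then show ?thesis by blast
qed

lemma interp_space_subset_infinity:
  assumes "0 < p"
  shows "interp_space A0 N0 A1 N1 \<theta> (ennreal p) \<subseteq> interp_space A0 N0 A1 N1 \<theta> \<infinity>"
proof
  fix x assume x: "x \<in> interp_space A0 N0 A1 N1 \<theta> (ennreal p)"
  then have xS: "x \<in> S" by (simp add: interp_space_def)
  show "x \<in> interp_space A0 N0 A1 N1 \<theta> \<infinity>"
    using x bounded_of_nn_integral_powr[OF assms, of "\<Phi> x"] \<Phi>_nonneg[OF xS]
    unfolding in_interp_space_iff[OF xS assms] in_interp_space_infinity_iff[OF xS] by blast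
qed

end

section \<open>Two-sided geometric sums\<close>

lemma nn_integral_geometric_int:
  fixes r :: real and j :: int
  assumes "0 \<le> r" "r < 1"
  shows "(\<integral>\<^sup>+k. ennreal (r ^ nat \<bar>k - j\<bar>) \<partial>count_space UNIV) < \<infinity>"
proof -
  have "(\<Sum>i. ennreal (r ^ i)) \<noteq> top"
    using assms by (intro ennreal_suminf_neq_top summable_geometric) auto
  then have nat: "(\<integral>\<^sup>+i. ennreal (r ^ i) \<partial>count_space UNIV) < \<infinity>"
    by (simp only: nn_integral_count_space_nat less_top infinity_ennreal_def)
  have "(\<integral>\<^sup>+k. ennreal (r ^ nat \<bar>k - j\<bar>) \<partial>count_space UNIV)
      = (\<integral>\<^sup>+k. ennreal (r ^ nat \<bar>k - j\<bar>) * indicator {j..} k + ennreal (r ^ nat \<bar>k - j\<bar>) * indicator {..<j} k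
          \<partial>count_space UNIV)"
    by (intro nn_integral_cong) (auto simp: indicator_def)
  also have "\<dots> = (\<integral>\<^sup>+k. ennreal (r ^ nat \<bar>k - j\<bar>) \<partial>count_space {j..})
      + (\<integral>\<^sup>+k. ennreal (r ^ nat \<bar>k - j\<bar>) \<partial>count_space {..<j})"
    by (simp add: nn_integral_add nn_integral_count_space_indicator)
  also have "(\<integral>\<^sup>+k. ennreal (r ^ nat \<bar>k - j\<bar>) \<partial>count_space {j..})
      = (\<integral>\<^sup>+i. ennreal (r ^ nat \<bar>(j + int i) - j\<bar>) \<partial>count_space UNIV)"
    by (rule nn_integral_bij_count_space[symmetric], rule bij_betwI[of _ _ _ "\<lambda>k. nat (k - j)"]) auto
  also have "(\<integral>\<^sup>+k. ennreal (r ^ nat \<bar>k - j\<bar>) \<partial>count_space {..<j})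
      = (\<integral>\<^sup>+i. ennreal (r ^ nat \<bar>(j - 1 - int i) - j\<bar>) \<partial>count_space UNIV)"
    by (rule nn_integral_bij_count_space[symmetric], rule bij_betwI[of _ _ _ "\<lambda>k. nat (j - 1 - k)"]) auto
  also have "(\<integral>\<^sup>+i. ennreal (r ^ nat \<bar>(j - 1 - int i) - j\<bar>) \<partial>count_space UNIV)
      \<le> (\<integral>\<^sup>+i. ennreal (r ^ i) \<partial>count_space UNIV)"
    \<comment> \<open>To the left of \<open>j\<close> the distances start at 1, so the terms
      \<open>r ^ (i + 1)\<close> are bounded by \<open>r ^ i\<close>.\<close>
    using assms by (intro nn_integral_mono ennreal_leI power_decreasing) auto
  also have "(\<integral>\<^sup>+i. ennreal (r ^ nat \<bar>(j + int i) - j\<bar>) \<partial>count_space UNIV)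
        + (\<integral>\<^sup>+i. ennreal (r ^ i) \<partial>count_space UNIV) < \<infinity>"
    using nat by (simp add: less_top)
  finally show ?thesis by (simp add: add_left_mono)
qed

lemma nn_integral_translate_int:
  "(\<integral>\<^sup>+k. f (k - j) \<partial>count_space UNIV) = (\<integral>\<^sup>+k. f (k :: int) \<partial>count_space UNIV)"
  by (rule nn_integral_bij_count_space, rule bij_betwI[of _ _ _ "\<lambda>k. k + j"]) auto

section \<open>Geometric decay and the collapse\<close>

context graded_pair
begin

lemma J\<theta>_nonneg: "v \<in> A0 \<inter> A1 \<Longrightarrow> 0 \<le> J\<theta> v k"
  using J_nonneg by (simp add: J\<theta>_def)

lemma J\<theta>_scale: "v \<in> A0 \<inter> A1 \<Longrightarrow> J\<theta> (c *\<^sub>R v) k = \<bar>c\<bar> * J\<theta> v k"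
  by (simp add: J\<theta>_def J_scale)

lemma \<Phi>_scale: "x \<in> S \<Longrightarrow> \<Phi> (c *\<^sub>R x) k = \<bar>c\<bar> * \<Phi> x k"
  using T_pos by (simp add: \<Phi>_def K_scale)

lemma \<Phi>_add: "x \<in> S \<Longrightarrow> y \<in> S \<Longrightarrow> \<Phi> (x + y) k \<le> C * (\<Phi> x k + \<Phi> y k)"
  using mult_left_mono[OF K_add[OF _ _ T_pos], of x y "T k powr - \<theta>" k]
  by (simp add: \<Phi>_def algebra_simps)

text \<open>The weights \<open>2 ^ min \<bar>k\<bar> n\<close> keep the supremum finite for each \<open>n\<close>. The kernel absorbs the
  factor by which they change from \<open>j\<close> to \<open>k\<close>, and outside the window it contracts by \<open>1/2\<close>, so the
  supremum is bounded independently of \<open>n\<close>.\<close>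
lemma \<Phi>_decay:
  assumes x: "x \<in> S" and M: "\<And>k. \<Phi> x k \<le> M"
    and \<delta>: "0 < \<delta>" "\<delta> \<le> 1" and small: "(2 * C) ^ 3 * (4 * C * a) * \<delta> powr \<sigma> \<le> 1 / 2"
    and window: "\<And>k v. W < nat \<bar>k\<bar> \<Longrightarrow> v \<in> A0 \<inter> A1 \<Longrightarrow> K v (T k) \<le> \<delta> * J v (T k)"
  shows "\<exists>R. \<forall>k. 2 ^ nat \<bar>k\<bar> * \<Phi> x k \<le> R"
proof (cases "\<forall>t>0. 0 < K x t")
  case False
  then obtain t where t: "0 < t" "K x t \<le> 0" by force
  \<comment> \<open>Monotonicity of \<open>K x t\<close> and of \<open>K x t / t\<close> spreads a
    zero at one scale to all scales.\<close>
  have "K x s \<le> 0" if s: "0 < s" for s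
  proof (cases "s \<le> t")
    case True
    then show ?thesis using K_mono[OF x s True] t by simp
  next
    case False
    then have "K x s \<le> s / t * K x t" using K_antimono[OF x t(1)] by simp
    also have "\<dots> \<le> 0" using s t by (intro mult_nonneg_nonpos) auto
    finally show ?thesis .
  qed
  then have "\<Phi> x k \<le> 0" for k
    using T_pos[of k] by (simp add: \<Phi>_def mult_nonneg_nonpos)
  then have "2 ^ nat \<bar>k\<bar> * \<Phi> x k \<le> 0" for k
    by (intro mult_nonneg_nonpos) auto
  then show ?thesis by blast
next
  case True
  then obtain u where sums: "K_sums u x" and u: "\<And>k. u k \<in> A0 \<inter> A1"
    and J: "\<And>k. J (u k) (T k) \<le> 4 * C * a * K x (T k)"
    using fundamental_decomposition[OF x _ M] by blast
  define E where "E = (2 * C) ^ 3 * (4 * C * a)"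
  have E: "0 < E" using C_ge_1 a_gt_1 by (simp add: E_def)
  have D3: "0 < (2 * C) ^ 3" using C_ge_1 by simp
  have JT: "(2 * C) ^ 3 * J\<theta> (u k) k \<le> E * \<Phi> x k" for k
  proof -
    have "J\<theta> (u k) k \<le> T k powr - \<theta> * (4 * C * a * K x (T k))"
      unfolding J\<theta>_def using J by (intro mult_left_mono) auto
    then have "(2 * C) ^ 3 * J\<theta> (u k) k \<le> (2 * C) ^ 3 * (T k powr - \<theta> * (4 * C * a * K x (T k)))"
      using D3 by (intro mult_left_mono) auto
    then show ?thesis by (simp add: E_def \<Phi>_def mult_ac)
  qed
  \<comment> \<open>Outside the window the small ratio \<delta> is available, inside it only the
    trivial ratio 1.\<close>
  define g where "g k = (if nat \<bar>k\<bar> \<le> W then 1 else \<delta>)" for k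
  have g: "0 < g k" "g k \<le> 1" for k using \<delta> by (auto simp: g_def)
  have Kg: "K (u k) (T k) \<le> g k * J (u k) (T k)" for k
    using window[OF _ u, of k k] K_le_J[OF u T_pos, of k k] by (auto simp: g_def)
  \<comment> \<open>\<open>R\<close> bounds what the window can contribute: there the weights are at
    most \<open>2 ^ W\<close> and \<open>\<Phi> x\<close> is at most \<open>M\<close>.\<close>
  define R where "R = 2 ^ W * (E * M)"
  have M0: "0 \<le> M" using M[of 0] \<Phi>_nonneg[OF x, of 0] by linarith
  have R0: "0 \<le> R" using E M0 by (simp add: R_def)
  have bound: "2 ^ min (nat \<bar>j\<bar>) n * \<Phi> x j \<le> R" for j n
  proof -
    define w where "w k = (2 ^ min (nat \<bar>k\<bar>) n :: real)" for k :: int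
    have w0: "0 < w k" for k by (simp add: w_def)
    have wle: "w j \<le> 2 ^ nat \<bar>k - j\<bar> * w k" for j k
    proof -
      \<comment> \<open>The truncated absolute value is 1-Lipschitz, so the weight changes by at
        most a factor 2 per step, which \<open>\<Phi>_sums_le\<close> tolerates.\<close>
      have "min (nat \<bar>j\<bar>) n \<le> nat \<bar>k - j\<bar> + min (nat \<bar>k\<bar>) n" by linarith
      then have "(2::real) ^ min (nat \<bar>j\<bar>) n \<le> 2 ^ (nat \<bar>k - j\<bar> + min (nat \<bar>k\<bar>) n)"
        by (intro power_increasing) auto
      then show ?thesis by (simp add: w_def power_add)
    qed
    define s where "s = (SUP k. w k * \<Phi> x k)"
    have "w k * \<Phi> x k \<le> 2 ^ n * M" for k
      using M \<Phi>_nonneg[OF x] by (intro mult_mono) (auto simp: w_def intro: power_increasing)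
    then have bdd: "bdd_above (range (\<lambda>k. w k * \<Phi> x k))" by (intro bdd_aboveI2)
    have s_ge: "w k * \<Phi> x k \<le> s" for k unfolding s_def by (intro cSUP_upper bdd) auto
    have s0: "0 \<le> s" using s_ge[of 0] w0[of 0] \<Phi>_nonneg[OF x, of 0]
      by (meson less_imp_le mult_nonneg_nonneg order_trans)
    have step: "w j * \<Phi> x j \<le> max (s / 2) R" for j
    proof -
      have key: "(2 * C) ^ 3 * (w k * (g k powr \<sigma> * J\<theta> (u k) k)) \<le> max (s / 2) R" for k
      proof -
        have "(2 * C) ^ 3 * (w k * (g k powr \<sigma> * J\<theta> (u k) k))
            = (w k * g k powr \<sigma>) * ((2 * C) ^ 3 * J\<theta> (u k) k)" by simp
        also have "\<dots> \<le> (w k * g k powr \<sigma>) * (E * \<Phi> x k)"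
          using JT w0[of k] by (intro mult_left_mono) auto
        also have "\<dots> \<le> max (s / 2) R"
        proof (cases "nat \<bar>k\<bar> \<le> W")
          case True
          have "w k \<le> 2 ^ W" using True by (auto simp: w_def intro: power_increasing)
          then have "w k * (E * \<Phi> x k) \<le> 2 ^ W * (E * M)"
            using E M \<Phi>_nonneg[OF x] by (intro mult_mono) auto
          then show ?thesis using True by (simp add: g_def R_def)
        next
          case False
          have "(w k * g k powr \<sigma>) * (E * \<Phi> x k) = (E * \<delta> powr \<sigma>) * (w k * \<Phi> x k)"
            using False by (simp add: g_def)
          also have "\<dots> \<le> 1 / 2 * s"
            using small s_ge[of k] w0[of k] \<Phi>_nonneg[OF x, of k]
            by (intro mult_mono) (auto simp: E_def)
          finally show ?thesis by simp
        qed
        finally show ?thesis .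
      qed
      have "\<Phi> x j \<le> (2 * C) ^ 3 * (max (s / 2) R / ((2 * C) ^ 3 * w j))"
      proof (rule \<Phi>_sums_le[OF sums u g Kg])
        fix k
        have "(2 * C) ^ 3 * w j * (g k powr \<sigma> * J\<theta> (u k) k)
            \<le> (2 * C) ^ 3 * (2 ^ nat \<bar>k - j\<bar> * w k) * (g k powr \<sigma> * J\<theta> (u k) k)"
          using wle[of j k] D3 J\<theta>_nonneg[OF u] by (intro mult_right_mono mult_left_mono) auto
        also have "\<dots> = 2 ^ nat \<bar>k - j\<bar> * ((2 * C) ^ 3 * (w k * (g k powr \<sigma> * J\<theta> (u k) k)))" by simp
        also have "\<dots> \<le> 2 ^ nat \<bar>k - j\<bar> * max (s / 2) R"
          using key by (intro mult_left_mono) auto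
        finally show "g k powr \<sigma> * J\<theta> (u k) k \<le> 2 ^ nat \<bar>k - j\<bar> * (max (s / 2) R / ((2 * C) ^ 3 * w j))"
          using D3 w0[of j] by (simp add: pos_le_divide_eq mult_ac)
      qed
      then show ?thesis using D3 w0[of j] by (simp add: pos_le_divide_eq mult_ac)
    qed
    have "s \<le> max (s / 2) R" unfolding s_def
      by (rule cSUP_least) (use step in \<open>auto simp: s_def\<close>)
    \<comment> \<open>If \<open>s \<le> s / 2\<close> then \<open>s = 0\<close>, so
      \<open>s \<le> R\<close> in either case. The truncation at \<open>n\<close> is what made
      \<open>s\<close> a finite supremum.\<close>
    then have "s \<le> R" using s0 R0 by linarith
    then show ?thesis using s_ge[of j] by (simp add: w_def)
  qed
  \<comment> \<open>At \<open>n = |k|\<close> the truncated weight is the full one, and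
    \<open>R\<close> does not depend on \<open>n\<close>.\<close>
  have "2 ^ nat \<bar>k\<bar> * \<Phi> x k \<le> R" for k using bound[of k "nat \<bar>k\<bar>"] by simp
  then show ?thesis by blast
qed

text \<open>Decay of \<open>\<Phi> x\<close> like \<open>2\<close> to the power \<open>- |k|\<close>
  makes all its positive powers summable, so the space with exponent \<infinity> lies in each of the
  others; the reverse inclusion always holds.\<close>

lemma collapse:
  assumes \<delta>: "0 < \<delta>" "\<delta> \<le> 1" and small: "(2 * C) ^ 3 * (4 * C * a) * \<delta> powr \<sigma> \<le> 1 / 2"
    and window: "\<And>k v. W < nat \<bar>k\<bar> \<Longrightarrow> v \<in> A0 \<inter> A1 \<Longrightarrow> K v (T k) \<le> \<delta> * J v (T k)"
    and p: "0 < p"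
  shows "interp_space A0 N0 A1 N1 \<theta> (ennreal p) = interp_space A0 N0 A1 N1 \<theta> \<infinity>"
proof (intro equalityI subsetI)
  fix x assume x: "x \<in> interp_space A0 N0 A1 N1 \<theta> \<infinity>"
  then have xS: "x \<in> S" by (simp add: interp_space_def)
  obtain M where M: "\<And>k. \<Phi> x k \<le> M" using x in_interp_space_infinity_iff[OF xS] by blast
  obtain R where R: "\<And>k. 2 ^ nat \<bar>k\<bar> * \<Phi> x k \<le> R"
    using \<Phi>_decay[OF xS M \<delta> small window] by blast
  have R0: "0 \<le> R" using R[of 0] \<Phi>_nonneg[OF xS, of 0] by simp
  define r where "r = (1 / 2 :: real) powr p"
  have r: "0 \<le> r" "r < 1" using p powr_less_mono2[of p "1 / 2" 1] by (auto simp: r_def)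
  have le: "\<Phi> x k powr p \<le> R powr p * r ^ nat \<bar>k - 0\<bar>" for k
  proof -
    have "\<Phi> x k \<le> R * (1 / 2) ^ nat \<bar>k\<bar>" using R[of k] by (simp add: field_simps)
    then have "\<Phi> x k powr p \<le> (R * (1 / 2) ^ nat \<bar>k\<bar>) powr p"
      using \<Phi>_nonneg[OF xS] p by (intro powr_mono2) auto
    also have "\<dots> = R powr p * ((1 / 2) ^ nat \<bar>k\<bar>) powr p" using R0 by (simp add: powr_mult)
    also have "((1 / 2 :: real) ^ nat \<bar>k\<bar>) powr p = r ^ nat \<bar>k\<bar>"
      unfolding r_def by (simp add: powr_powr mult.commute flip: powr_realpow)
    finally show ?thesis by simp
  qed
  have "(\<integral>\<^sup>+k. ennreal (\<Phi> x k powr p) \<partial>count_space UNIV)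
      \<le> (\<integral>\<^sup>+k. ennreal (R powr p) * ennreal (r ^ nat \<bar>k - 0\<bar>) \<partial>count_space UNIV)"
    using le r by (intro nn_integral_mono) (simp add: ennreal_leI flip: ennreal_mult)
  also have "\<dots> = ennreal (R powr p) * (\<integral>\<^sup>+k. ennreal (r ^ nat \<bar>k - 0\<bar>) \<partial>count_space UNIV)"
    by (rule nn_integral_cmult) simp
  also have "\<dots> < \<infinity>" using nn_integral_geometric_int[OF r, of 0] by (simp add: ennreal_mult_less_top)
  finally show "x \<in> interp_space A0 N0 A1 N1 \<theta> (ennreal p)"
    by (simp only: in_interp_space_iff[OF xS p])
qed (use interp_space_subset_infinity[OF p] in blast)

section \<open>Convergence of series supported on one side\<close>

lemma K_sums_nonpos:
  assumes v: "\<And>k. v k \<in> A0" and zero: "\<And>k. 0 \<le> k \<Longrightarrow> v k = 0"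
    and x: "x \<in> A0" "(\<lambda>n. N0 (x - (\<Sum>i<n. v (- 1 - int i)))) \<longlonglongrightarrow> 0"
  shows "K_sums v x"
proof -
  \<comment> \<open>The indices \<open>- 1 - int i\<close> run through the negative integers, so the
    two-sided window reduces to a one-sided partial sum.\<close>
  have eq: "(\<Sum>k\<in>{- int n..<int n}. v k) = (\<Sum>i<n. v (- 1 - int i))" for n
  proof -
    have "(\<Sum>k\<in>{- int n..<int n}. v k) = (\<Sum>k\<in>(\<lambda>i. - 1 - int i) ` {..<n}. v k)"
    proof (rule sum.mono_neutral_right)
      show "\<forall>k\<in>{- int n..<int n} - (\<lambda>i. - 1 - int i) ` {..<n}. v k = 0"
      proof
        fix k assume k: "k \<in> {- int n..<int n} - (\<lambda>i. - 1 - int i) ` {..<n}"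
        have "0 \<le> k"
        proof (rule ccontr)
          assume "\<not> 0 \<le> k"
          then have "k = - 1 - int (nat (- 1 - k))" "nat (- 1 - k) < n" using k by auto
          then show False using k by blast
        qed
        then show "v k = 0" by (rule zero)
      qed
    qed auto
    then show ?thesis by (simp add: sum.reindex inj_on_def)
  qed
  have in_A0: "x - (\<Sum>i<n. v (- 1 - int i)) \<in> A0" for n
    using v x by (intro subspace_diff[OF sub0] subspace_sum[OF sub0])
  have "(\<lambda>n. K (x - (\<Sum>k\<in>{- int n..<int n}. v k)) t) \<longlonglongrightarrow> 0" if t: "0 < t" for t
    unfolding eq
    \<comment> \<open>\<open>N0\<close> dominates \<open>K\<close> at every \<open>t\<close>, so
      convergence in \<open>A0\<close> implies convergence in the sum space.\<close>
    by (rule tendsto_sandwich[OF _ _ tendsto_const x(2)])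
      (use K_le_N0[OF in_A0 t] K_nonneg[OF A0_S[OF in_A0] t] in auto)
  then show ?thesis using v x A0_S by (simp add: K_sums_def)
qed

text \<open>The mirror image in \<open>A1\<close>, where \<open>K\<close> at \<open>t\<close> is at
  most \<open>t\<close> times \<open>N1\<close>.\<close>

lemma K_sums_nonneg:
  assumes v: "\<And>k. v k \<in> A1" and zero: "\<And>k. k < 0 \<Longrightarrow> v k = 0"
    and x: "x \<in> A1" "(\<lambda>n. N1 (x - (\<Sum>i<n. v (int i)))) \<longlonglongrightarrow> 0"
  shows "K_sums v x"
proof -
  have eq: "(\<Sum>k\<in>{- int n..<int n}. v k) = (\<Sum>i<n. v (int i))" for n
  proof -
    have "(\<Sum>k\<in>{- int n..<int n}. v k) = (\<Sum>k\<in>int ` {..<n}. v k)"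
    proof (rule sum.mono_neutral_right)
      show "\<forall>k\<in>{- int n..<int n} - int ` {..<n}. v k = 0"
      proof
        fix k assume k: "k \<in> {- int n..<int n} - int ` {..<n}"
        have "k < 0"
        proof (rule ccontr)
          assume "\<not> k < 0"
          then have "k = int (nat k)" "nat k < n" using k by auto
          then show False using k by blast
        qed
        then show "v k = 0" by (rule zero)
      qed
    qed auto
    then show ?thesis by (simp add: sum.reindex)
  qed
  have in_A1: "x - (\<Sum>i<n. v (int i)) \<in> A1" for n
    using v x by (intro subspace_diff[OF sub1] subspace_sum[OF sub1])
  have "(\<lambda>n. K (x - (\<Sum>k\<in>{- int n..<int n}. v k)) t) \<longlonglongrightarrow> 0" if t: "0 < t" for t
    unfolding eq
  proof (rule tendsto_sandwich[OF _ _ tendsto_const])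
    have "(\<lambda>n. t * N1 (x - (\<Sum>i<n. v (int i)))) \<longlonglongrightarrow> t * 0"
      by (intro tendsto_intros x)
    then show "(\<lambda>n. t * N1 (x - (\<Sum>i<n. v (int i)))) \<longlonglongrightarrow> 0" by simp
  qed (use K_le_N1[OF in_A1 t] K_nonneg[OF A1_S[OF in_A1] t] in auto)
  then show ?thesis using v x A1_S by (simp add: K_sums_def)
qed

lemma power_le_T_powr:
  assumes e: "2 * \<sigma> \<le> e"
  shows "(4 * C) ^ i \<le> T (int i) powr e"
proof -
  have "(4 * C) ^ i \<le> (a powr \<sigma>) ^ i" using a_large C_ge_1 by (intro power_mono) auto
  also have "\<dots> = a powr (\<sigma> * real i)" using a_gt_1 by (simp add: powr_powr flip: powr_realpow)
  also have "\<dots> \<le> a powr (e * real i)"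
    using a_gt_1 e \<sigma> by (intro powr_mono mult_right_mono) auto
  also have "\<dots> = T (int i) powr e" by (simp add: T_def powr_powr mult.commute)
  finally show ?thesis .
qed

text \<open>The normalisation bounds \<open>N0 (v k)\<close> by \<open>T k powr \<theta>\<close>,
  which decays geometrically as \<open>k\<close> decreases, and \<open>N1 (v k)\<close> by
  \<open>T k powr (\<theta> - 1)\<close>, which decays as \<open>k\<close> increases. A series on
  one side therefore converges by completeness of a single space.\<close>

lemma K_sums_exists:
  assumes v: "\<And>k. v k \<in> A0 \<inter> A1" and J: "\<And>k. J\<theta> (v k) k \<le> 1"
    and side: "(\<forall>k\<ge>0. v k = 0) \<or> (\<forall>k<0. v k = 0)"
  shows "\<exists>x. K_sums v x"
  using side
proof
  assume zero: "\<forall>k\<ge>0. v k = 0"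
  have "(4 * C) ^ i * N0 (v (- 1 - int i)) \<le> 1" for i
  proof -
    let ?k = "- 1 - int i"
    have "(4 * C) ^ i \<le> T (int i) powr \<theta>" using \<sigma> by (intro power_le_T_powr)
    \<comment> \<open>The negative indices start at -1, so \<open>- ?k\<close> is
      \<open>int i + 1\<close>; monotonicity of \<open>T\<close> bridges the gap of one.\<close>
    also have "\<dots> \<le> T (- ?k) powr \<theta>"
      using \<theta> T_mono[of "int i" "- ?k"] T_pos[of "int i"] by (intro powr_mono2) auto
    also have "\<dots> = T ?k powr - \<theta>"
      by (simp add: T_def powr_powr) (simp add: algebra_simps)
    finally have "(4 * C) ^ i * N0 (v ?k) \<le> T ?k powr - \<theta> * J (v ?k) (T ?k)"
      using v N0_nonneg by (intro mult_mono) (auto simp: J_def)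
    then show ?thesis using J[of ?k] by (simp add: J\<theta>_def)
  qed
  then obtain x where "x \<in> A0" "(\<lambda>n. N0 (x - (\<Sum>i<n. v (- 1 - int i)))) \<longlonglongrightarrow> 0"
    using quasi_complete_geometric[OF sub0 C_ge_1, of N0 "\<lambda>i. v (- 1 - int i)"]
      N0_scale[of 0 0] subspace_0[OF sub0] N0_add N0_minus complete0 v by auto
  then show ?thesis using K_sums_nonpos[of v x] v zero by blast
next
  assume zero: "\<forall>k<0. v k = 0"
  have "(4 * C) ^ i * N1 (v (int i)) \<le> 1" for i
  proof -
    have "(4 * C) ^ i \<le> T (int i) powr (1 - \<theta>)" using \<sigma> by (intro power_le_T_powr)
    also have "\<dots> = T (int i) powr - \<theta> * T (int i)"
      using T_pos[of "int i"] by (simp add: powr_diff powr_minus divide_inverse mult.commute)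
    finally have "(4 * C) ^ i * N1 (v (int i)) \<le> T (int i) powr - \<theta> * (T (int i) * N1 (v (int i)))"
      using v N1_nonneg mult_right_mono[of "(4 * C) ^ i" "T (int i) powr - \<theta> * T (int i)" "N1 (v (int i))"]
      by (simp add: mult.assoc)
    also have "\<dots> \<le> J\<theta> (v (int i)) (int i)"
      unfolding J\<theta>_def by (intro mult_left_mono) (auto simp: J_def)
    finally show ?thesis using J[of "int i"] by simp
  qed
  then obtain x where "x \<in> A1" "(\<lambda>n. N1 (x - (\<Sum>i<n. v (int i)))) \<longlonglongrightarrow> 0"
    using quasi_complete_geometric[OF sub1 C_ge_1, of N1 "\<lambda>i. v (int i)"]
      N1_scale[of 0 0] subspace_0[OF sub1] N1_add N1_minus complete1 v by auto
  then show ?thesis using K_sums_nonneg[of v x] v zero by blast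
qed

end

section \<open>Separating the spaces\<close>

text \<open>Greedy choice: an infinite set of naturals always has an element at least
  \<open>L\<close> above the one chosen last.\<close>

lemma sparse_enumeration_nat:
  fixes M :: "nat set" and L :: nat
  assumes "infinite M"
  shows "\<exists>m. (\<forall>n. m n \<in> M) \<and> (\<forall>i j. i \<le> j \<longrightarrow> m i + L * (j - i) \<le> m j)"
proof -
  have "\<exists>x. x \<in> M" using assms infinite_imp_nonempty by blast
  moreover have "\<exists>y. y \<in> M \<and> x + L \<le> y" for x
    using assms unfolding infinite_nat_iff_unbounded_le by blast
  ultimately obtain m where m: "\<And>n. m n \<in> M" and step: "\<And>n. m n + L \<le> m (Suc n)"
    using dependent_nat_choice[of "\<lambda>_ x. x \<in> M" "\<lambda>_ x y. x + L \<le> y"] by blast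
  have "m i + L * d \<le> m (i + d)" for i d
  proof (induction d)
    case (Suc d)
    then show ?case using step[of "i + d"] by simp
  qed simp
  then have "m i + L * (j - i) \<le> m j" if "i \<le> j" for i j
    using that by (metis le_add_diff_inverse)
  then show ?thesis using m by blast
qed

text \<open>One of the two half-lines contains infinitely many points of \<open>B\<close>; it is
  parametrised isometrically by the naturals, where the greedy choice applies. The common sign is
  what lets the separating series converge in a single space.\<close>

lemma sparse_enumeration_int:
  fixes B :: "int set" and L :: nat
  assumes "infinite B"
  shows "\<exists>\<kappa> :: nat \<Rightarrow> int. (\<forall>n. \<kappa> n \<in> B) \<and>
    (\<forall>i j. L * nat \<bar>int i - int j\<bar> \<le> nat \<bar>\<kappa> i - \<kappa> j\<bar>) \<and>
    ((\<forall>n. \<kappa> n < 0) \<or> (\<forall>n. 0 \<le> \<kappa> n))"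
proof -
  have main: "\<exists>m. (\<forall>n. e (m n) \<in> B) \<and> (\<forall>i j. L * nat \<bar>int i - int j\<bar> \<le> nat \<bar>e (m i) - e (m j)\<bar>)"
    if inf: "infinite (B \<inter> range e)" and e: "\<And>i j. \<bar>e i - e j\<bar> = \<bar>int i - int j\<bar>" for e :: "nat \<Rightarrow> int"
  proof -
    have "B \<inter> range e = e ` {i. e i \<in> B}" by blast
    then have "infinite {i. e i \<in> B}" using inf by (metis finite_imageI)
    then obtain m where m: "\<And>n. e (m n) \<in> B"
      and gap: "\<And>i j. i \<le> j \<Longrightarrow> m i + L * (j - i) \<le> m j"
      using sparse_enumeration_nat[of "{i. e i \<in> B}" L] by blast
    have "L * nat \<bar>int i - int j\<bar> \<le> nat \<bar>e (m i) - e (m j)\<bar>" for i j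
    proof (cases "i \<le> j")
      case True
      then have ij: "nat \<bar>int i - int j\<bar> = j - i" by linarith
      have "nat \<bar>e (m i) - e (m j)\<bar> = m j - m i" unfolding e using gap[OF True] by linarith
      then show ?thesis unfolding ij using gap[OF True] by linarith
    next
      case False
      then have ij: "nat \<bar>int i - int j\<bar> = i - j" by linarith
      have "nat \<bar>e (m i) - e (m j)\<bar> = m i - m j"
        unfolding e using gap[of j i] False by linarith
      then show ?thesis unfolding ij using gap[of j i] False by linarith
    qed
    then show ?thesis using m by blast
  qed
  have "B \<subseteq> (B \<inter> range int) \<union> (B \<inter> range (\<lambda>i. - 1 - int i))"
  proof
    fix k assume "k \<in> B"
    moreover have "k = int (nat k) \<or> k = - 1 - int (nat (- 1 - k))" by linarith
    ultimately show "k \<in> (B \<inter> range int) \<union> (B \<inter> range (\<lambda>i. - 1 - int i))" by blast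
  qed
  then have "infinite (B \<inter> range int) \<or> infinite (B \<inter> range (\<lambda>i. - 1 - int i))"
    using assms finite_subset by auto
  then show ?thesis
  proof
    assume inf: "infinite (B \<inter> range int)"
    obtain m where m: "\<forall>n. int (m n) \<in> B"
      and gap: "\<forall>i j. L * nat \<bar>int i - int j\<bar> \<le> nat \<bar>int (m i) - int (m j)\<bar>"
      using main[of int, OF inf refl] by blast
    from m gap show ?thesis by (intro exI[of _ "\<lambda>n. int (m n)"] conjI disjI2 allI of_nat_0_le_iff) blast+
  next
    assume inf: "infinite (B \<inter> range (\<lambda>i. - 1 - int i))"
    have e: "\<bar>(- 1 - int i) - (- 1 - int j)\<bar> = \<bar>int i - int j\<bar>" for i j by linarith
    obtain m where m: "\<forall>n. - 1 - int (m n) \<in> B"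
      and gap: "\<forall>i j. L * nat \<bar>int i - int j\<bar> \<le> nat \<bar>(- 1 - int (m i)) - (- 1 - int (m j))\<bar>"
      using main[of "\<lambda>i. - 1 - int i", OF inf e] by blast
    have "- 1 - int (m n) < 0" for n by simp
    with m gap show ?thesis by (intro exI[of _ "\<lambda>n. - 1 - int (m n)"] conjI disjI1 allI) blast+
  qed
qed

text \<open>At index distance \<open>d\<close> the quotient of the two powers is at most
  \<open>(d + 1) powr (1 / p)\<close>, hence at most \<open>2 powr (d / p)\<close>. An
  \<open>L\<close> above \<open>1 / p + |log 2 (1 / \<epsilon>)|\<close> absorbs this and the factor
  \<open>1 / \<epsilon>\<close>, since \<open>d\<close> is at least 1.\<close>

lemma powr_slowly_varying:
  fixes p \<epsilon> :: real
  assumes p: "0 < p" and \<epsilon>: "0 < \<epsilon>"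
  shows "\<exists>L\<ge>1. \<forall>m n. m \<noteq> n \<longrightarrow>
    real (Suc m) powr (- 1 / p) \<le> 2 ^ (L * nat \<bar>int m - int n\<bar>) * (\<epsilon> * real (Suc n) powr (- 1 / p))"
proof -
  obtain L0 :: nat where L0: "1 / p + \<bar>log 2 (1 / \<epsilon>)\<bar> < real L0" using reals_Archimedean2 by blast
  define L where "L = max 1 L0"
  have L: "1 \<le> L" "1 / p + \<bar>log 2 (1 / \<epsilon>)\<bar> \<le> real L" using L0 by (auto simp: L_def)
  have "real (Suc m) powr (- 1 / p) \<le> 2 ^ (L * nat \<bar>int m - int n\<bar>) * (\<epsilon> * real (Suc n) powr (- 1 / p))"
    if mn: "m \<noteq> n" for m n
  proof -
    define d where "d = nat \<bar>int m - int n\<bar>"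
    have d: "1 \<le> d" using mn by (simp add: d_def)
    have "Suc n \<le> Suc m * Suc d"
    proof -
      have "n \<le> m + d" by (simp add: d_def)
      also have "\<dots> \<le> m + Suc m * d" by simp
      finally show ?thesis by simp
    qed
    also have "\<dots> \<le> Suc m * 2 ^ d" by (intro mult_left_mono) (auto simp: Suc_leI less_exp)
    finally have "real (Suc n) \<le> real (Suc m * 2 ^ d)" by (rule of_nat_mono)
    then have "real (Suc n) \<le> real (Suc m) * 2 ^ d"
      by (simp only: of_nat_mult of_nat_power of_nat_numeral)
    then have "(real (Suc m) * 2 ^ d) powr (- 1 / p) \<le> real (Suc n) powr (- 1 / p)"
      using p by (intro powr_mono2') auto
    then have "real (Suc m) powr (- 1 / p) * 2 powr (real d * (- 1 / p)) \<le> real (Suc n) powr (- 1 / p)"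
      by (simp add: powr_mult powr_powr flip: powr_realpow)
    then have le: "2 powr (real d * (1 / p)) * (real (Suc m) powr (- 1 / p) * 2 powr (real d * (- 1 / p)))
        \<le> 2 powr (real d * (1 / p)) * real (Suc n) powr (- 1 / p)"
      by (intro mult_left_mono) auto
    have inv: "2 powr (real d * (1 / p)) * 2 powr (real d * (- 1 / p)) = (1::real)"
      by (simp flip: powr_add)
    have 1: "real (Suc m) powr (- 1 / p) \<le> 2 powr (real d * (1 / p)) * real (Suc n) powr (- 1 / p)"
      using le unfolding mult.left_commute[of _ "real (Suc m) powr (- 1 / p)"] inv mult_1_right .
    have "real d * (1 / p) \<le> real (L * d) - log 2 (1 / \<epsilon>)"
    proof -
      have "\<bar>log 2 (1 / \<epsilon>)\<bar> \<le> real d * \<bar>log 2 (1 / \<epsilon>)\<bar>"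
        using d mult_right_mono[of 1 "real d" "\<bar>log 2 (1 / \<epsilon>)\<bar>"] by simp
      moreover have "real d * (1 / p + \<bar>log 2 (1 / \<epsilon>)\<bar>) \<le> real d * real L"
        using L by (intro mult_left_mono) auto
      ultimately show ?thesis by (simp add: distrib_left mult.commute)
    qed
    then have "2 powr (real d * (1 / p)) \<le> 2 powr (real (L * d) - log 2 (1 / \<epsilon>))"
      by (intro powr_mono) auto
    also have "\<dots> = 2 ^ (L * d) * \<epsilon>"
      using \<epsilon> powr_realpow[of 2 "L * d"] by (simp add: powr_diff)
    finally have "2 powr (real d * (1 / p)) * real (Suc n) powr (- 1 / p)
        \<le> 2 ^ (L * d) * \<epsilon> * real (Suc n) powr (- 1 / p)"
      by (intro mult_right_mono) auto
    from order_trans[OF 1 this] show ?thesis unfolding d_def by (simp only: mult.assoc)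
  qed
  then show ?thesis using L(1) by blast
qed

section \<open>Construction of the separating element\<close>

context graded_pair
begin

text \<open>One \<open>x\<close> serves all \<open>q > p\<close> at once. Its peaks
  \<open>\<Phi> x (\<kappa> n)\<close> are at least a multiple of \<open>c n\<close>, whose
  \<open>p\<close>-th powers form the harmonic series, while geometric tails around the peaks keep
  the \<open>q\<close>-th powers summable.\<close>

lemma separating_element:
  assumes \<delta>: "0 < \<delta>"
    and inf: "infinite {k. \<exists>v\<in>A0 \<inter> A1. \<delta> * J v (T k) < K v (T k)}"
    and p: "0 < p"
  shows "\<exists>x. x \<notin> interp_space A0 N0 A1 N1 \<theta> (ennreal p) \<and>
    (\<forall>q>p. x \<in> interp_space A0 N0 A1 N1 \<theta> (ennreal q))"
proof -
  define D where "D = (2 * C) ^ 3"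
  have D: "0 < D" using C_ge_1 by (simp add: D_def)
  \<comment> \<open>The choice makes \<open>C * D * \<epsilon> = \<delta> / 2\<close>, so that all
    other terms together cost at most half of the peak at \<open>\<kappa> n\<close>.\<close>
  define \<epsilon> where "\<epsilon> = \<delta> / (2 * C * D)"
  have \<epsilon>: "0 < \<epsilon>" using \<delta> D C_ge_1 by (simp add: \<epsilon>_def)
  define c where "c n = real (Suc n) powr (- 1 / p)" for n
  have c: "0 < c n" "c n \<le> 1" for n
    using p by (auto simp: c_def powr_minus_divide field_simps ge_one_powr_ge_zero)
  obtain L where L: "1 \<le> L" "\<And>m n. m \<noteq> n \<Longrightarrow> c m \<le> 2 ^ (L * nat \<bar>int m - int n\<bar>) * (\<epsilon> * c n)"
    using powr_slowly_varying[OF p \<epsilon>] unfolding c_def by blast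
  obtain \<kappa> :: "nat \<Rightarrow> int" where \<kappa>: "\<And>n. \<kappa> n \<in> {k. \<exists>v\<in>A0 \<inter> A1. \<delta> * J v (T k) < K v (T k)}"
    and gap: "\<And>i j. L * nat \<bar>int i - int j\<bar> \<le> nat \<bar>\<kappa> i - \<kappa> j\<bar>"
    and side: "(\<forall>n. \<kappa> n < 0) \<or> (\<forall>n. 0 \<le> \<kappa> n)"
    using sparse_enumeration_int[OF inf, of L] by blast
  have inj: "inj \<kappa>"
  proof (rule injI)
    fix i j assume "\<kappa> i = \<kappa> j"
    then have "L * nat \<bar>int i - int j\<bar> = 0" using gap[of i j] by simp
    then show "i = j" using L(1) by simp
  qed
  have "\<exists>u. u \<in> A0 \<inter> A1 \<and> J\<theta> u (\<kappa> n) = 1 \<and> \<delta> \<le> \<Phi> u (\<kappa> n)" for n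
  proof -
    obtain v where v: "v \<in> A0 \<inter> A1" "\<delta> * J v (T (\<kappa> n)) < K v (T (\<kappa> n))" using \<kappa>[of n] by blast
    have vS: "v \<in> S" using v A0_S by blast
    \<comment> \<open>If \<open>J\<close> vanished, so would \<open>K\<close>, against the strict
      inequality; hence \<open>v\<close> can be normalised.\<close>
    have "0 < J v (T (\<kappa> n))"
      using v(2) K_le_J[OF v(1) T_pos] J_nonneg[OF v(1), of "T (\<kappa> n)"] \<delta>
        mult_nonneg_nonneg[of \<delta> "J v (T (\<kappa> n))"]
      by (smt (verit))
    then have JT: "0 < J\<theta> v (\<kappa> n)" using T_pos[of "\<kappa> n"] by (simp add: J\<theta>_def)
    have "T (\<kappa> n) powr - \<theta> * (\<delta> * J v (T (\<kappa> n))) \<le> T (\<kappa> n) powr - \<theta> * K v (T (\<kappa> n))"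
      using v(2) by (intro mult_left_mono) auto
    then have "\<delta> * J\<theta> v (\<kappa> n) \<le> \<Phi> v (\<kappa> n)" by (simp add: J\<theta>_def \<Phi>_def mult_ac)
    moreover have "(1 / J\<theta> v (\<kappa> n)) *\<^sub>R v \<in> A0 \<inter> A1"
      using v(1) subspace_scale[OF sub0] subspace_scale[OF sub1] by blast
    ultimately show ?thesis
      using v(1) vS JT
      by (intro exI[of _ "(1 / J\<theta> v (\<kappa> n)) *\<^sub>R v"]) (simp add: J\<theta>_scale \<Phi>_scale field_simps)
  qed
  then obtain u where u: "\<And>n. u n \<in> A0 \<inter> A1" "\<And>n. J\<theta> (u n) (\<kappa> n) = 1" "\<And>n. \<delta> \<le> \<Phi> (u n) (\<kappa> n)"
    by metis
  \<comment> \<open>The terms are put at their positions \<open>\<kappa> n\<close>, with zeros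
    elsewhere, which turns the sparse family into a series over all integers.\<close>
  define v where "v k = (if k \<in> range \<kappa> then c (inv \<kappa> k) *\<^sub>R u (inv \<kappa> k) else 0)" for k
  have v\<kappa>: "v (\<kappa> n) = c n *\<^sub>R u n" for n using inj by (simp add: v_def)
  have v0: "v k = 0" if "k \<notin> range \<kappa>" for k using that by (simp add: v_def)
  have zero: "0 \<in> A0 \<inter> A1" using subspace_0[OF sub0] subspace_0[OF sub1] by blast
  have J0: "J\<theta> 0 k = 0" for k using J\<theta>_scale[OF zero, of 0 k] by simp
  have v: "v k \<in> A0 \<inter> A1" for k
    using u(1) zero subspace_scale[OF sub0] subspace_scale[OF sub1] by (auto simp: v_def)
  have Jv: "J\<theta> (v (\<kappa> n)) (\<kappa> n) = c n" for n
    using c[of n] u(2) J\<theta>_scale[OF u(1)] by (simp add: v\<kappa>)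
  have "J\<theta> (v k) k \<le> 1" for k
    by (cases "k \<in> range \<kappa>") (use Jv c(2) v0 J0 in auto)
  moreover have "(\<forall>k\<ge>0. v k = 0) \<or> (\<forall>k<0. v k = 0)"
    using side v0 by (metis image_iff linorder_not_less)
  ultimately obtain x where sums: "K_sums v x" using K_sums_exists[of v, OF v] by blast
  have xS: "x \<in> S" and vS: "v k \<in> S" for k using sums by (auto simp: K_sums_def)
  \<comment> \<open>Upper bounds use \<open>\<Phi>_sums_le\<close> with the trivial ratio 1 of
    \<open>K\<close> to \<open>J\<close>.\<close>
  have upper: "\<Phi> y j \<le> D * B"
    if "K_sums w y" "\<And>k. w k \<in> A0 \<inter> A1" "\<And>k. J\<theta> (w k) k \<le> 2 ^ nat \<bar>k - j\<bar> * B" for w y j B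
    unfolding D_def by (rule \<Phi>_sums_le[OF that(1,2), of "\<lambda>_. 1"]) (use that K_le_J T_pos in auto)
  \<comment> \<open>A reverse triangle inequality: \<open>v (\<kappa> n)\<close> is \<open>x\<close>
    minus the series with that term deleted, and the latter is small at \<open>\<kappa> n\<close> by
    sparseness.\<close>
  have lower: "\<delta> / (2 * C) * c n \<le> \<Phi> x (\<kappa> n)" for n
  proof -
    have "\<delta> * c n \<le> \<Phi> (v (\<kappa> n)) (\<kappa> n)"
      using u(3)[of n] c[of n] u(1)[of n] A0_S by (simp add: v\<kappa> \<Phi>_scale mult.commute)
    also have "v (\<kappa> n) = x + - (x - v (\<kappa> n))" by simp
    also have "\<Phi> (x + - (x - v (\<kappa> n))) (\<kappa> n) \<le> C * (\<Phi> x (\<kappa> n) + \<Phi> (- (x - v (\<kappa> n))) (\<kappa> n))"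
      using xS vS by (intro \<Phi>_add subspace_neg[OF subspace_S] subspace_diff[OF subspace_S])
    also have "\<Phi> (- (x - v (\<kappa> n))) (\<kappa> n) = \<Phi> (x - v (\<kappa> n)) (\<kappa> n)"
      using K_minus[OF subspace_diff[OF subspace_S xS vS] T_pos] by (simp add: \<Phi>_def)
    finally have 1: "\<delta> * c n \<le> C * (\<Phi> x (\<kappa> n) + \<Phi> (x - v (\<kappa> n)) (\<kappa> n))" .
    have "\<Phi> (x - v (\<kappa> n)) (\<kappa> n) \<le> D * (\<epsilon> * c n)"
    proof (rule upper[OF K_sums_remove[OF sums]])
      show "(v(\<kappa> n := 0)) k \<in> A0 \<inter> A1" for k using v zero by simp
      fix k
      show "J\<theta> ((v(\<kappa> n := 0)) k) k \<le> 2 ^ nat \<bar>k - \<kappa> n\<bar> * (\<epsilon> * c n)"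
      proof (cases "k \<in> range \<kappa> \<and> k \<noteq> \<kappa> n")
        case True
        then obtain m where m: "k = \<kappa> m" "m \<noteq> n" by blast
        have "c m \<le> 2 ^ (L * nat \<bar>int m - int n\<bar>) * (\<epsilon> * c n)" by (rule L(2)[OF m(2)])
        also have "\<dots> \<le> 2 ^ nat \<bar>\<kappa> m - \<kappa> n\<bar> * (\<epsilon> * c n)"
          using gap[of m n] \<epsilon> c(1)[of n] by (intro mult_right_mono power_increasing) auto
        finally show ?thesis using True by (simp add: m(1) Jv)
      next
        case False
        then have "(v(\<kappa> n := 0)) k = 0" using v0 by auto
        then show ?thesis using \<epsilon> c(1)[of n] by (simp add: J0 less_imp_le)
      qed
    qed
    then have "C * (\<Phi> x (\<kappa> n) + \<Phi> (x - v (\<kappa> n)) (\<kappa> n)) \<le> C * (\<Phi> x (\<kappa> n) + D * (\<epsilon> * c n))"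
      using C_ge_1 by (intro mult_left_mono) auto
    with 1 have "\<delta> * c n \<le> C * \<Phi> x (\<kappa> n) + C * D * \<epsilon> * c n" by (simp add: algebra_simps)
    also have "C * D * \<epsilon> = \<delta> / 2" using C_ge_1 D by (simp add: \<epsilon>_def)
    finally show ?thesis using C_ge_1 by (simp add: field_simps)
  qed
  have "x \<notin> interp_space A0 N0 A1 N1 \<theta> (ennreal p)"
  proof
    assume "x \<in> interp_space A0 N0 A1 N1 \<theta> (ennreal p)"
    then have fin: "(\<integral>\<^sup>+k. ennreal (\<Phi> x k powr p) \<partial>count_space UNIV) < \<infinity>"
      by (simp only: in_interp_space_iff[OF xS p])
    define \<eta> where "\<eta> = (\<delta> / (2 * C)) powr p"
    have \<eta>: "0 < \<eta>" using \<delta> C_ge_1 by (simp add: \<eta>_def)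
    have le: "\<eta> * inverse (real (Suc n)) \<le> \<Phi> x (\<kappa> n) powr p" for n
    proof -
      have "c n powr p = inverse (real (Suc n))" 
        using p powr_minus[of "real (Suc n)" 1] unfolding c_def powr_powr by simp
      then have "\<eta> * inverse (real (Suc n)) = (\<delta> / (2 * C) * c n) powr p"
        using \<delta> C_ge_1 c(1)[of n] by (subst powr_mult) (auto simp: \<eta>_def)
      also have "\<dots> \<le> \<Phi> x (\<kappa> n) powr p"
        using lower[of n] p \<delta> C_ge_1 c(1)[of n] by (intro powr_mono2) auto
      finally show ?thesis .
    qed
    have "(\<Sum>n. ennreal (\<eta> * inverse (real (Suc n)))) \<le> (\<Sum>n. ennreal (\<Phi> x (\<kappa> n) powr p))"
      using le by (intro suminf_le ennreal_leI) auto
    also have "\<dots> = (\<integral>\<^sup>+n. ennreal (\<Phi> x (\<kappa> n) powr p) \<partial>count_space UNIV)"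
      by (rule nn_integral_count_space_nat[symmetric])
    also have "\<dots> = (\<integral>\<^sup>+k. ennreal (\<Phi> x k powr p) \<partial>count_space (range \<kappa>))"
      using inj by (intro nn_integral_bij_count_space) (simp add: bij_betw_def)
    also have "\<dots> = (\<integral>\<^sup>+k. ennreal (\<Phi> x k powr p) * indicator (range \<kappa>) k \<partial>count_space UNIV)"
      by (simp add: nn_integral_count_space_indicator)
    also have "\<dots> \<le> (\<integral>\<^sup>+k. ennreal (\<Phi> x k powr p) \<partial>count_space UNIV)"
      by (intro nn_integral_mono) (auto simp: indicator_def)
    also note fin
    finally have "(\<Sum>n. ennreal (\<eta> * inverse (real (Suc n)))) \<noteq> top" by (simp only: less_top infinity_ennreal_def)
    then have "summable (\<lambda>n. \<eta> * inverse (real (Suc n)))"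
      using \<eta> by (intro summable_suminf_not_top) auto
    then have "summable (\<lambda>n. inverse (real (Suc n)))" using \<eta> by (simp add: summable_cmult_iff)
    then have "summable (\<lambda>n. inverse (real n))" by (simp only: summable_Suc_iff[of "\<lambda>n. inverse (real n)"])
    then show False using not_summable_harmonic[where 'a = real] by simp
  qed
  moreover have "x \<in> interp_space A0 N0 A1 N1 \<theta> (ennreal q)" if q: "p < q" for q
  proof -
    have q0: "0 < q" using p q by simp
    define r where "r = (1 / 2 :: real) powr q"
    have r: "0 \<le> r" "r < 1" using q0 powr_less_mono2[of q "1 / 2" 1] by (auto simp: r_def)
    have r_pow: "r ^ n = ((1 / 2) ^ n) powr q" for n
      unfolding r_def by (simp add: powr_powr mult.commute flip: powr_realpow)
    have cq: "c n powr q = real (Suc n) powr (- (q / p))" for n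
      by (simp add: c_def powr_powr)
    \<comment> \<open>Here \<open>q > p\<close> enters: the exponent \<open>q / p\<close> exceeds
      1.\<close>
    have "summable (\<lambda>n. real n powr (- (q / p)))" using p q by (simp add: summable_real_powr_iff)
    then have sc: "summable (\<lambda>n. c n powr q)"
      using summable_Suc_iff[of "\<lambda>n. real n powr (- (q / p))"] by (simp only: cq)
    \<comment> \<open>Up to a constant, \<open>h j n\<close> is the \<open>q\<close>-th power of
      what the term at \<open>\<kappa> n\<close> may contribute at \<open>j\<close>, with the kernel
      weakened to powers of \<open>1 / 2\<close>.\<close>
    define h where "h j n = c n powr q * r ^ nat \<bar>j - \<kappa> n\<bar>" for j n
    have h0: "0 \<le> h j n" for j n using r by (simp add: h_def)
    have h_le: "h j n \<le> c n powr q" for j n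
      using r power_le_one[of r] by (simp add: h_def mult_left_le)
    have sh: "summable (h j)" for j
      by (rule summable_comparison_test'[OF sc, of 0]) (use h0 h_le in auto)
    have le: "\<Phi> x j powr q \<le> D powr q * suminf (h j)" for j
    proof -
      \<comment> \<open>Each \<open>h j n\<close> is at most the whole sum, so \<open>B\<close>
        dominates every single term, as \<open>upper\<close> requires.\<close>
      define B where "B = suminf (h j) powr (1 / q)"
      have s0: "0 \<le> suminf (h j)" using sh h0 by (intro suminf_nonneg)
      have "\<Phi> x j \<le> D * B"
      proof (rule upper[OF sums v])
        fix k
        show "J\<theta> (v k) k \<le> 2 ^ nat \<bar>k - j\<bar> * B"
        proof (cases "k \<in> range \<kappa>")
          case True
          then obtain n where n: "k = \<kappa> n" by blast
          have "h j n \<le> suminf (h j)" using sum_le_suminf[OF sh, of "{n}" j] h0 by simp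
          then have "h j n powr (1 / q) \<le> B"
            using h0 q0 unfolding B_def by (intro powr_mono2) auto
          also have "h j n = (c n * (1 / 2) ^ nat \<bar>j - \<kappa> n\<bar>) powr q"
            using c(1)[of n] by (simp add: h_def r_pow powr_mult)
          finally have "c n * (1 / 2) ^ nat \<bar>j - \<kappa> n\<bar> \<le> B"
            using c(1)[of n] q0 by (simp add: powr_powr)
          then show ?thesis by (simp add: n Jv field_simps abs_minus_commute)
        qed (simp add: v0 J0 B_def)
      qed
      then have "\<Phi> x j powr q \<le> (D * B) powr q"
        using \<Phi>_nonneg[OF xS] q0 by (intro powr_mono2) auto
      also have "\<dots> = D powr q * suminf (h j)"
        using D q0 s0 by (simp add: powr_mult B_def powr_powr)
      finally show ?thesis .
    qed
    let ?Z = "\<integral>\<^sup>+k. ennreal (r ^ nat \<bar>k - 0\<bar>) \<partial>count_space (UNIV :: int set)"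
    have "(\<integral>\<^sup>+j. ennreal (\<Phi> x j powr q) \<partial>count_space UNIV)
        \<le> (\<integral>\<^sup>+j. ennreal (D powr q) * (\<integral>\<^sup>+n. ennreal (h j n) \<partial>count_space UNIV) \<partial>count_space UNIV)"
    proof (rule nn_integral_mono)
      fix j
      have "(\<Sum>n. ennreal (h j n)) = ennreal (suminf (h j))"
        using h0 sh by (intro suminf_ennreal_eq summable_sums) auto
      then have "(\<integral>\<^sup>+n. ennreal (h j n) \<partial>count_space UNIV) = ennreal (suminf (h j))"
        by (simp only: nn_integral_count_space_nat)
      then show "ennreal (\<Phi> x j powr q) \<le> ennreal (D powr q) * (\<integral>\<^sup>+n. ennreal (h j n) \<partial>count_space UNIV)"
        using le[of j] suminf_nonneg[OF sh h0] by (simp add: ennreal_leI flip: ennreal_mult)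
    qed
    also have "\<dots> = ennreal (D powr q)
        * (\<integral>\<^sup>+j. (\<integral>\<^sup>+n. ennreal (h j n) \<partial>count_space UNIV) \<partial>count_space UNIV)"
      by (rule nn_integral_cmult) simp
    also have "(\<integral>\<^sup>+j. (\<integral>\<^sup>+n. ennreal (h j n) \<partial>count_space UNIV) \<partial>count_space UNIV)
        = (\<integral>\<^sup>+n. (\<integral>\<^sup>+j. ennreal (h j n) \<partial>count_space UNIV) \<partial>count_space UNIV)"
      \<comment> \<open>After this exchange the sum over \<open>j\<close> is a translate of one
        geometric sum, whatever \<open>n\<close> is.\<close>
      by (rule nn_integral_count_space_nn_integral) auto
    also have "\<dots> = (\<integral>\<^sup>+n. ennreal (c n powr q) * ?Z \<partial>count_space UNIV)"
    proof (rule nn_integral_cong)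
      fix n
      have "(\<integral>\<^sup>+j. ennreal (h j n) \<partial>count_space UNIV)
          = (\<integral>\<^sup>+j. ennreal (c n powr q) * ennreal (r ^ nat \<bar>j - \<kappa> n\<bar>) \<partial>count_space UNIV)"
        using r by (simp add: h_def ennreal_mult)
      also have "\<dots> = ennreal (c n powr q) * (\<integral>\<^sup>+j. ennreal (r ^ nat \<bar>j - \<kappa> n\<bar>) \<partial>count_space UNIV)"
        by (rule nn_integral_cmult) simp
      also have "(\<integral>\<^sup>+j. ennreal (r ^ nat \<bar>j - \<kappa> n\<bar>) \<partial>count_space UNIV) = ?Z"
        using nn_integral_translate_int[of "\<lambda>k. ennreal (r ^ nat \<bar>k\<bar>)" "\<kappa> n"] by simp
      finally show "(\<integral>\<^sup>+j. ennreal (h j n) \<partial>count_space UNIV) = ennreal (c n powr q) * ?Z" .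
    qed
    also have "\<dots> = (\<Sum>n. ennreal (c n powr q)) * ?Z"
      by (simp only: nn_integral_count_space_nat ennreal_suminf_multc)
    also have "(\<Sum>n. ennreal (c n powr q)) = ennreal (\<Sum>n. c n powr q)"
      using sc by (intro suminf_ennreal_eq summable_sums) auto
    also have "ennreal (D powr q) * (ennreal (\<Sum>n. c n powr q) * ?Z) < \<infinity>"
      using nn_integral_geometric_int[OF r, of 0] by (simp add: ennreal_mult_less_top)
    finally show ?thesis by (simp only: in_interp_space_iff[OF xS q0])
  qed
  ultimately show ?thesis by blast
qed

section \<open>The dichotomy\<close>

lemma collapse_or_distinct:
  "(\<forall>p q. 0 < p \<longrightarrow> 0 < q \<longrightarrow>
      interp_space A0 N0 A1 N1 \<theta> p = interp_space A0 N0 A1 N1 \<theta> q) \<or>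
   (\<forall>p q. 0 < p \<longrightarrow> 0 < q \<longrightarrow> p \<noteq> q \<longrightarrow>
      interp_space A0 N0 A1 N1 \<theta> p \<noteq> interp_space A0 N0 A1 N1 \<theta> q)"
proof -
  let ?I = "interp_space A0 N0 A1 N1 \<theta>"
  define E where "E = (2 * C) ^ 3 * (4 * C * a)"
  have "1 * (4 * 1 * 1) \<le> E"
    unfolding E_def using C_ge_1 a_gt_1 by (intro mult_mono one_le_power) auto
  then have E: "4 \<le> E" by simp
  \<comment> \<open>\<delta> solves \<open>E * \<delta> powr \<sigma> = 1 / 2\<close>, which is the
    contraction factor that the decay argument needs.\<close>
  define \<delta> where "\<delta> = (1 / (2 * E)) powr (1 / \<sigma>)"
  have \<delta>: "0 < \<delta>" "\<delta> \<le> 1"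
    using E \<sigma> powr_mono2[of "1 / \<sigma>" "1 / (2 * E)" 1] by (auto simp: \<delta>_def)
  have small: "(2 * C) ^ 3 * (4 * C * a) * \<delta> powr \<sigma> \<le> 1 / 2"
    using E \<sigma> unfolding E_def[symmetric] by (simp add: \<delta>_def powr_powr)
  show ?thesis
  \<comment> \<open>What decides is whether some element has a ratio of \<open>K\<close> to
    \<open>J\<close> above \<delta> at only finitely many scales or at infinitely many.\<close>
  proof (cases "finite {k. \<exists>v\<in>A0 \<inter> A1. \<delta> * J v (T k) < K v (T k)}")
    case True
    then obtain W where W: "\<And>k. k \<in> {k. \<exists>v\<in>A0 \<inter> A1. \<delta> * J v (T k) < K v (T k)} \<Longrightarrow> nat \<bar>k\<bar> \<le> W"
      using finite_nat_set_iff_bounded_le[of "(\<lambda>k. nat \<bar>k\<bar>) ` {k. \<exists>v\<in>A0 \<inter> A1. \<delta> * J v (T k) < K v (T k)}"]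
      by auto
    have window: "K v (T k) \<le> \<delta> * J v (T k)" if "W < nat \<bar>k\<bar>" "v \<in> A0 \<inter> A1" for k v
      using W[of k] that by force
    have eq: "?I p = ?I \<infinity>" if "0 < p" for p
    proof (cases p)
      case (real p')
      then show ?thesis using collapse[OF \<delta> small window, where p = p'] that by simp
    qed simp
    have "?I p = ?I q" if "0 < p" "0 < q" for p q using eq[OF that(1)] eq[OF that(2)] by simp
    then show ?thesis by blast
  next
    case False
    have less: "?I p \<noteq> ?I q" if pq: "0 < p" "p < q" for p q
    proof -
      obtain p' where p': "p = ennreal p'" "0 < p'"
        using pq by (cases p) auto
      obtain x where x: "x \<notin> ?I (ennreal p')" "\<And>r. p' < r \<Longrightarrow> x \<in> ?I (ennreal r)"
        using separating_element[OF \<delta>(1) False p'(2)] by blast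
      have "x \<in> ?I q"
      proof (cases q)
        case (real q')
        then show ?thesis using x(2)[of q'] pq(2) p' by (simp add: ennreal_less_iff)
      next
        \<comment> \<open>The exponent \<infinity> is reached through the finite exponent
          \<open>p' + 1\<close>, whose space it contains.\<close>
        case top
        then show ?thesis
          using interp_space_subset_infinity[of "p' + 1"] x(2)[of "p' + 1"] p' by auto
      qed
      then show ?thesis using x(1) p'(1) by blast
    qed
    have "?I p \<noteq> ?I q" if "0 < p" "0 < q" "p \<noteq> q" for p q
      using less[of p q] less[of q p] that by (metis neq_iff)
    then show ?thesis by blast
  qed
qed

end

theorem corollary2p11:
  fixes A0 A1 :: "'a::hausdorff_real_tvs set"
    and N0 N1 :: "'a \<Rightarrow> real"
    and \<theta> :: real
  assumes "quasi_banach_couple A0 N0 A1 N1"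
    and "\<not> closedin (couple_sum_topology A0 N0 A1 N1) (A0 \<inter> A1)"
    and "0 < \<theta>" and "\<theta> < 1"
  shows "(\<forall>p q::ennreal. 0 < p \<longrightarrow> 0 < q \<longrightarrow>
            interp_space A0 N0 A1 N1 \<theta> p = interp_space A0 N0 A1 N1 \<theta> q) \<or>
         (\<forall>p q::ennreal. 0 < p \<longrightarrow> 0 < q \<longrightarrow> p \<noteq> q \<longrightarrow>
            interp_space A0 N0 A1 N1 \<theta> p \<noteq> interp_space A0 N0 A1 N1 \<theta> q)"
proof -
  obtain C where C: "quasi_banach_pair A0 A1 N0 N1 C"
    using assms(1) quasi_banach_pair_exists unfolding quasi_banach_couple_def by blast
  then interpret quasi_banach_pair A0 A1 N0 N1 C .
  \<comment> \<open>Half the distance from \<theta> to the nearer endpoint.\<close>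
  define \<sigma> where "\<sigma> = min \<theta> (1 - \<theta>) / 2"
  have \<sigma>: "0 < \<sigma>" "2 * \<sigma> \<le> \<theta>" "2 * \<sigma> \<le> 1 - \<theta>" using assms(3,4) by (auto simp: \<sigma>_def)
  \<comment> \<open>With this base, \<open>a powr \<sigma>\<close> is exactly
    \<open>4 * C\<close>.\<close>
  have "(4 * C) powr (1 / \<sigma>) > 1"
    using C_ge_1 \<sigma> powr_less_mono2[of "1 / \<sigma>" 1 "4 * C"] by simp
  then interpret graded_pair A0 A1 N0 N1 C \<theta> "(4 * C) powr (1 / \<sigma>)" \<sigma>
    using assms(3,4) \<sigma> C_ge_1 by unfold_locales (auto simp: powr_powr)
  show ?thesis by (rule collapse_or_distinct)
qed

end
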